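(* Let $\Gamma_\delta$ be the metric path (chain) graph $A_4$ with four vertices $V_1,V_2,V_3,V_4$ and three edges of lengths $l_1,l_2,l_3$, joining $V_1$ to $V_2$, $V_2$ to $V_3$, and $V_3$ to $V_4$ respectively. Assume that all vertices are of $\delta$ type and that $l_1,l_2,l_3$ are rationally independent. Let $A_{\vec\alpha}$ and $A_{\vec{\widetilde\alpha}}$ be two graph Laplacians on $\Gamma_\delta$ with coupling constants $\vec\alpha,\vec{\widetilde\alpha}\in\mathbb R^4$, and assume that the coupling constants at both internal vertices $V_2$, $V_3$ are non-zero for both Laplacians. If the spectra of $A_{\vec\alpha}$ and $A_{\vec{\widetilde\alpha}}$ coincide counting multiplicities, then $\vec\alpha=\vec{\widetilde\alpha}$.
   Context: A finite compact metric graph $\Gamma$ consists of finitely many compact intervals (edges) $\Delta_j=[x_{2j-1},x_{2j}]$ together with a partition of the set of endpoints into classes $V_1,V_2,\dots$ (vertices). The valence $\gamma_k=\deg V_k$ is the number of endpoints belonging to $V_k$; a vertex is internal if its valence is greater than 1. Put $L_2(\Gamma)=\bigoplus_j L_2(\Delta_j)$, $W_2^2(\Gamma)=\bigoplus_j W_2^2(\Delta_j)$. The normal derivative of $f\in W_2^2(\Gamma)$ at an endpoint is $\partial_n f(x_j)=f'(x_j)$ if $x_j$ is the left endpoint of its edge and $-f'(x_j)$ if it is the right endpoint. When all vertices are of $\delta$ type and $\vec\alpha$ is a vector of real coupling constants (one constant $\alpha_k$ for each vertex $V_k$), the graph Laplacian $A_{\vec\alpha}$ is the self-adjoint operator in $L_2(\Gamma)$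 acting on each edge as $-\frac{d^2}{dx^2}$, on the domain of all $f\in W_2^2(\Gamma)$ that are continuous at every vertex (i.e. $f(x_i)=f(x_j)=:f(V_k)$ for all $x_i,x_j\in V_k$) and satisfy $\sum_{x_j\in V_k}\partial_n f(x_j)=\alpha_k f(V_k)$ for every $k$. Its spectrum is purely discrete. Edge lengths are called rationally independent if they are linearly independent over $\mathbb Q$. *)

theory Defs
  imports "HOL-Analysis.Analysis" "HOL-Library.Function_Algebras"
begin

subsection \<open>Compact metric graphs\<close>

text \<open>
  Edge j (for j = 1, ..., n_edges) is the interval from pt (2j-1) to pt (2j); endpoints are
  referred to by their index i in {1..2 * n_edges}, so that endpoints of different edges stay
  distinct even if the intervals meet as subsets of the real line. The vertices vert 1, ...,
  vert n_verts are sets of endpoint indices.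
\<close>

record metric_graph =
  n_edges :: nat
  pt :: "nat \<Rightarrow> real"
  n_verts :: nat
  vert :: "nat \<Rightarrow> nat set"

definition wf_graph :: "metric_graph \<Rightarrow> bool" where
  "wf_graph \<Gamma> \<longleftrightarrow>
     (\<forall>j\<in>{1..n_edges \<Gamma>}. pt \<Gamma> (2*j - 1) < pt \<Gamma> (2*j)) \<and>
     (\<forall>k\<in>{1..n_verts \<Gamma>}. vert \<Gamma> k \<noteq> {}) \<and>
     disjoint_family_on (vert \<Gamma>) {1..n_verts \<Gamma>} \<and>
     (\<Union>k\<in>{1..n_verts \<Gamma>}. vert \<Gamma> k) = {1..2 * n_edges \<Gamma>}"

definition edge :: "metric_graph \<Rightarrow> nat \<Rightarrow> real set" where
  "edge \<Gamma> j = {pt \<Gamma> (2*j - 1) .. pt \<Gamma> (2*j)}"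

definition edge_length :: "metric_graph \<Rightarrow> nat \<Rightarrow> real" where
  "edge_length \<Gamma> j = pt \<Gamma> (2*j) - pt \<Gamma> (2*j - 1)"

text \<open>The index of the edge to which the endpoint with index i belongs.\<close>

definition endpoint_edge :: "nat \<Rightarrow> nat" where
  "endpoint_edge i = (i + 1) div 2"

definition joins :: "metric_graph \<Rightarrow> nat \<Rightarrow> nat \<Rightarrow> nat \<Rightarrow> bool" where
  "joins \<Gamma> j k m \<longleftrightarrow>
     (2*j - 1 \<in> vert \<Gamma> k \<and> 2*j \<in> vert \<Gamma> m) \<or> (2*j - 1 \<in> vert \<Gamma> m \<and> 2*j \<in> vert \<Gamma> k)"

text \<open>No orientation of the edges along the chain is prescribed.\<close>

definition chain_A4 :: "metric_graph \<Rightarrow> bool" where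
  "chain_A4 \<Gamma> \<longleftrightarrow> wf_graph \<Gamma> \<and> n_edges \<Gamma> = 3 \<and> n_verts \<Gamma> = 4 \<and>
     joins \<Gamma> 1 1 2 \<and> joins \<Gamma> 2 2 3 \<and> joins \<Gamma> 3 3 4"

definition rationally_independent :: "'i set \<Rightarrow> ('i \<Rightarrow> real) \<Rightarrow> bool" where
  "rationally_independent I l \<longleftrightarrow>
     (\<forall>c :: 'i \<Rightarrow> rat. (\<Sum>i\<in>I. of_rat (c i) * l i) = 0 \<longrightarrow> (\<forall>i\<in>I. c i = 0))"


subsection \<open>Function spaces on a metric graph\<close>

text \<open>
  A function on a graph is given by its components f j on the edges j, each extended by 0 outside
  edge j. Elements of the Hilbert space are represented by functions; two of them represent the
  same element iff they agree almost everywhere. An element of the Sobolev space is represented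
  by its unique continuously differentiable representative.
\<close>

type_synonym gfun = "nat \<Rightarrow> real \<Rightarrow> complex"

definition supported :: "metric_graph \<Rightarrow> gfun \<Rightarrow> bool" where
  "supported \<Gamma> f \<longleftrightarrow> (\<forall>j x. \<not> (j \<in> {1..n_edges \<Gamma>} \<and> x \<in> edge \<Gamma> j) \<longrightarrow> f j x = 0)"

definition L2_on :: "real set \<Rightarrow> (real \<Rightarrow> complex) \<Rightarrow> bool" where
  "L2_on S h \<longleftrightarrow> h \<in> borel_measurable (lebesgue_on S) \<and>
     integrable (lebesgue_on S) (\<lambda>x. (norm (h x))\<^sup>2)"

definition L2 :: "metric_graph \<Rightarrow> gfun set" where
  "L2 \<Gamma> = {f. supported \<Gamma> f \<and> (\<forall>j\<in>{1..n_edges \<Gamma>}. L2_on (edge \<Gamma> j) (f j))}"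

definition L2_norm :: "metric_graph \<Rightarrow> gfun \<Rightarrow> real" where
  "L2_norm \<Gamma> f =
     sqrt (\<Sum>j\<in>{1..n_edges \<Gamma>}. integral\<^sup>L (lebesgue_on (edge \<Gamma> j)) (\<lambda>x. (norm (f j x))\<^sup>2))"

text \<open>
  u is in the Sobolev space of order 2 over the interval [a, b] and its second derivative is
  (the class of) h: u is differentiable with absolutely continuous derivative, the latter being
  an indefinite integral of the square integrable function h.
\<close>

definition second_deriv :: "real \<Rightarrow> real \<Rightarrow> (real \<Rightarrow> complex) \<Rightarrow> (real \<Rightarrow> complex) \<Rightarrow> bool" where
  "second_deriv a b u h \<longleftrightarrow> L2_on {a..b} h \<and>
     (\<exists>u'. (\<forall>x\<in>{a..b}. (u has_vector_derivative u' x) (at x within {a..b})) \<and>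
           (\<forall>x\<in>{a..b}. (h has_integral (u' x - u' a)) {a..x}))"

definition W22 :: "metric_graph \<Rightarrow> gfun set" where
  "W22 \<Gamma> = {f. supported \<Gamma> f \<and>
     (\<forall>j\<in>{1..n_edges \<Gamma>}. \<exists>h. second_deriv (pt \<Gamma> (2*j - 1)) (pt \<Gamma> (2*j)) (f j) h)}"

definition value_at :: "metric_graph \<Rightarrow> gfun \<Rightarrow> nat \<Rightarrow> complex" where
  "value_at \<Gamma> f i = f (endpoint_edge i) (pt \<Gamma> i)"

text \<open>Left endpoints are those with odd index.\<close>

definition normal_deriv :: "metric_graph \<Rightarrow> gfun \<Rightarrow> nat \<Rightarrow> complex" where
  "normal_deriv \<Gamma> f i =
     (if odd i then 1 else -1) *
     vector_derivative (f (endpoint_edge i)) (at (pt \<Gamma> i) within edge \<Gamma> (endpoint_edge i))"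


subsection \<open>Graph Laplacians with vertices of delta type\<close>

definition laplacian_dom :: "metric_graph \<Rightarrow> (nat \<Rightarrow> real) \<Rightarrow> gfun set" where
  "laplacian_dom \<Gamma> \<alpha> = {f \<in> W22 \<Gamma>. \<forall>k\<in>{1..n_verts \<Gamma>}.
     \<exists>v. (\<forall>i\<in>vert \<Gamma> k. value_at \<Gamma> f i = v) \<and>
         (\<Sum>i\<in>vert \<Gamma> k. normal_deriv \<Gamma> f i) = of_real (\<alpha> k) * v}"

text \<open>
  Operators in the Hilbert space are represented by their graphs: the pair (f, g) means that f is
  in the domain and g represents the image of f. Thus g is determined almost everywhere by f.
\<close>

definition laplacian :: "metric_graph \<Rightarrow> (nat \<Rightarrow> real) \<Rightarrow> (gfun \<times> gfun) set" where
  "laplacian \<Gamma> \<alpha> = {(f, g). f \<in> laplacian_dom \<Gamma> \<alpha> \<and> g \<in> L2 \<Gamma> \<and>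
     (\<forall>j\<in>{1..n_edges \<Gamma>}.
        second_deriv (pt \<Gamma> (2*j - 1)) (pt \<Gamma> (2*j)) (f j) (\<lambda>x. - g j x))}"


subsection \<open>Spectrum and multiplicities\<close>

definition gscale :: "complex \<Rightarrow> gfun \<Rightarrow> gfun" where
  "gscale c f = (\<lambda>j x. c * f j x)"

lemma vector_space_gscale: "vector_space gscale"
  by unfold_locales (simp_all add: gscale_def fun_eq_iff algebra_simps)

text \<open>
  For an operator T, the pair (f, gscale z f + g) belongs to T iff (T - z) f = g. The point z is
  in the resolvent set iff T - z is a bijection from the domain of T onto the Hilbert space with
  bounded inverse. Uniqueness of f is uniqueness as an element of the Hilbert space, because
  operator domains consist of distinguished representatives.
\<close>

definition resolvent_set :: "metric_graph \<Rightarrow> (gfun \<times> gfun) set \<Rightarrow> complex set" where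
  "resolvent_set \<Gamma> T = {z.
     (\<forall>g\<in>L2 \<Gamma>. \<exists>!f. (f, gscale z f + g) \<in> T) \<and>
     (\<exists>C. \<forall>g\<in>L2 \<Gamma>. \<forall>f. (f, gscale z f + g) \<in> T \<longrightarrow> L2_norm \<Gamma> f \<le> C * L2_norm \<Gamma> g)}"

definition spectrum :: "metric_graph \<Rightarrow> (gfun \<times> gfun) set \<Rightarrow> complex set" where
  "spectrum \<Gamma> T = - resolvent_set \<Gamma> T"

definition eigenspace :: "(gfun \<times> gfun) set \<Rightarrow> complex \<Rightarrow> gfun set" where
  "eigenspace T z = {f. (f, gscale z f) \<in> T}"

text \<open>
  The complex dimension of the kernel of T - z. The library's dimension is 0 for
  infinite-dimensional spaces, but eigenspaces of a graph Laplacian have dimension at most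
  2 * n_edges.
\<close>

definition multiplicity :: "(gfun \<times> gfun) set \<Rightarrow> complex \<Rightarrow> nat" where
  "multiplicity T z = vector_space.dim gscale (eigenspace T z)"

text \<open>
  Coincidence of spectra counting multiplicities, for operators with purely discrete spectrum.
\<close>

definition isospectral ::
  "metric_graph \<Rightarrow> (gfun \<times> gfun) set \<Rightarrow> (gfun \<times> gfun) set \<Rightarrow> bool" where
  "isospectral \<Gamma> S T \<longleftrightarrow> spectrum \<Gamma> S = spectrum \<Gamma> T \<and>
     (\<forall>z\<in>spectrum \<Gamma> S. multiplicity S z = multiplicity T z)"

end

theory Submission
  imports Defs
begin

text \<open>
  A solution of the eigenvalue equation for \<open>k\<^sup>2\<close>, with \<open>k > 0\<close>, can be followed along the chain from
  one end to the other and is determined by its value at the first vertex. Hence every such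
  eigenvalue is simple, and \<open>k\<^sup>2\<close> is an eigenvalue if and only if \<open>k\<close> is a zero of the secular function,
  the defect in the matching condition at the last vertex (\<open>multiplicity_chain\<close>). Isospectral
  Laplacians thus have secular functions with the same positive zeros
  (\<open>isospectral_imp_secular_eq_0\<close>), and the large ones already determine the coupling constants.

  Put \<open>\<phi>\<^sub>j = k l\<^sub>j\<close>. If derivatives are divided by \<open>k\<close>, the secular function is a polynomial in
  \<open>1 / k\<close> whose coefficients are trigonometric polynomials in the phases \<open>\<phi>\<^sub>j\<close>, with leading term
  \<open>- sin (\<phi>\<^sub>1 + \<phi>\<^sub>2 + \<phi>\<^sub>3)\<close>
  (\<open>secular_expansion\<close>). The leading term does not involve the coupling constants. By rational
  independence and Kronecker's theorem, for all \<open>\<theta>\<^sub>1 + \<theta>\<^sub>2 + \<theta>\<^sub>3 = 0\<close> there are arbitrarily large zeros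
  \<open>k\<close> at which the phases are arbitrarily close to the \<open>\<theta>\<^sub>j\<close> modulo \<open>2 \<pi>\<close> (\<open>resonance\<close>). Passing to the
  limit along such zeros compares the coefficients of the two expansions at \<open>\<theta>\<close>
  (\<open>secular_coefficients_eq\<close>). At first order one obtains that
  \<open>\<alpha>\<^sub>1 + \<alpha>\<^sub>4 + \<alpha>\<^sub>2 (cos \<theta>\<^sub>1)\<^sup>2 + \<alpha>\<^sub>3 (cos \<theta>\<^sub>3)\<^sup>2\<close>
  is the same for both operators, so that \<open>\<alpha>\<^sub>2\<close>, \<open>\<alpha>\<^sub>3\<close> and \<open>\<alpha>\<^sub>1 + \<alpha>\<^sub>4\<close> are. The first order terms then
  agree identically, and the second order terms determine \<open>\<alpha>\<^sub>2 (\<alpha>\<^sub>1 - \<alpha>\<^sub>4)\<close>. As \<open>\<alpha>\<^sub>2\<close> is not zero, all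
  four constants are determined.
\<close>

section \<open>The eigenvalue equation on a single edge\<close>

text \<open>
  The solution of \<open>- u'' = k\<^sup>2 u\<close> with \<open>u(0) = A\<close> and \<open>u'(0) = k B\<close>. Dividing derivatives by
  \<open>k\<close> turns the flow of the equation into a rotation and the coupling constants into \<open>\<alpha> / k\<close>, which
  are small at high energy.
\<close>

definition wave :: "real \<Rightarrow> complex \<Rightarrow> complex \<Rightarrow> real \<Rightarrow> complex" where
  "wave k A B y = of_real (cos (k * y)) * A + of_real (sin (k * y)) * B"

lemma wave_derivative:
  "((\<lambda>x. wave k A B (x - a)) has_vector_derivative of_real k * wave k B (- A) (x - a)) (at x within S)"
proof -
  have c: "((\<lambda>x. cos (k * (x - a))) has_real_derivative - (k * sin (k * (x - a)))) (at x within S)"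
    by (auto intro!: derivative_eq_intros)
  have s: "((\<lambda>x. sin (k * (x - a))) has_real_derivative k * cos (k * (x - a))) (at x within S)"
    by (auto intro!: derivative_eq_intros)
  from has_vector_derivative_add[OF has_vector_derivative_mult_left[OF has_vector_derivative_of_real[OF c], of A]
      has_vector_derivative_mult_left[OF has_vector_derivative_of_real[OF s], of B]]
  show ?thesis by (simp add: wave_def algebra_simps)
qed

lemma continuous_on_imp_L2_on:
  assumes "continuous_on {a..b} (h :: real \<Rightarrow> complex)"
  shows "L2_on {a..b} h"
proof -
  have "continuous_on {a..b} (\<lambda>x. (norm (h x))\<^sup>2)"
    using assms by (intro continuous_intros)
  then have "(\<lambda>x. (norm (h x))\<^sup>2) absolutely_integrable_on {a..b}"
    by (rule absolutely_integrable_continuous_real)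
  then have "integrable (lebesgue_on {a..b}) (\<lambda>x. (norm (h x))\<^sup>2)"
    by (simp add: set_integrable_def integrable_restrict_space)
  moreover have "h \<in> borel_measurable (lebesgue_on {a..b})"
    using assms by (intro continuous_imp_measurable_on_sets_lebesgue) auto
  ultimately show ?thesis by (simp add: L2_on_def)
qed

lemma wave_second_deriv:
  assumes "a \<le> b" and u: "\<And>x. x \<in> {a..b} \<Longrightarrow> u x = wave k A B (x - a)"
  shows "second_deriv a b u (\<lambda>x. - (of_real (k\<^sup>2) * u x))"
proof -
  let ?u' = "\<lambda>x. of_real k * wave k B (- A) (x - a)"
  let ?h = "\<lambda>x. - (of_real (k\<^sup>2) * u x)"
  have du: "(u has_vector_derivative ?u' x) (at x within {a..b})" if "x \<in> {a..b}" for x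
    by (rule has_vector_derivative_transform[OF that _ wave_derivative]) (simp add: u)
  have du': "(?u' has_vector_derivative ?h x) (at x within {a..x'})" if "x \<in> {a..b}" for x x'
    using has_vector_derivative_mult_right[OF wave_derivative[of k B "- A" a x "{a..x'}"], of "of_real k"]
    by (simp add: u[OF that] wave_def algebra_simps power2_eq_square)
  have "(?h has_integral (?u' x - ?u' a)) {a..x}" if "x \<in> {a..b}" for x
    using that by (intro fundamental_theorem_of_calculus du') auto
  moreover have "L2_on {a..b} ?h"
  proof (rule continuous_on_imp_L2_on)
    have "continuous_on {a..b} u"
      using du by (meson continuous_on_eq_continuous_within has_vector_derivative_continuous)
    then show "continuous_on {a..b} ?h" by (intro continuous_intros)
  qed
  ultimately show ?thesis
    unfolding second_deriv_def using du by (intro conjI exI[of _ ?u']) auto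
qed

text \<open>
  The equation is assumed only in integrated form. Since \<open>u\<close> is continuous, so is the right-hand
  side, and the equation therefore holds pointwise and can be integrated by variation of constants.
\<close>

lemma second_deriv_imp_wave:
  assumes "a \<le> b" "k > 0" and u: "second_deriv a b u (\<lambda>x. - (of_real (k\<^sup>2) * u x))"
  obtains A B where "\<And>x. x \<in> {a..b} \<Longrightarrow> u x = wave k A B (x - a)"
proof -
  let ?h = "\<lambda>x. - (of_real (k\<^sup>2) * u x)"
  obtain u' where du: "\<And>x. x \<in> {a..b} \<Longrightarrow> (u has_vector_derivative u' x) (at x within {a..b})"
    and int: "\<And>x. x \<in> {a..b} \<Longrightarrow> (?h has_integral (u' x - u' a)) {a..x}"
    using u unfolding second_deriv_def by blast
  have "continuous_on {a..b} u"
    using du by (meson continuous_on_eq_continuous_within has_vector_derivative_continuous)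
  then have "continuous_on {a..b} ?h" by (intro continuous_intros)
  then have dint: "((\<lambda>y. u' a + integral {a..y} ?h) has_vector_derivative ?h x) (at x within {a..b})"
    if "x \<in> {a..b}" for x
    using has_vector_derivative_add[OF has_vector_derivative_const integral_has_vector_derivative[of a b ?h x]] that
    by simp
  have du': "(u' has_vector_derivative ?h x) (at x within {a..b})" if "x \<in> {a..b}" for x
  proof (rule has_vector_derivative_transform[OF that _ dint[OF that]])
    show "u' y = u' a + integral {a..y} ?h" if "y \<in> {a..b}" for y
      using integral_unique[OF int[OF that]] by (metis add.commute diff_add_cancel)
  qed
  define v where "v x = u' x / of_real k" for x
  have du: "(u has_vector_derivative of_real k * v x) (at x within {a..b})" if "x \<in> {a..b}" for x
    using du[OF that] \<open>k > 0\<close> by (simp add: v_def)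
  have dv: "(v has_vector_derivative - (of_real k * u x)) (at x within {a..b})" if "x \<in> {a..b}" for x
    unfolding v_def
    using has_vector_derivative_mult_right[OF du'[OF that], of "1 / of_real k"] \<open>k > 0\<close>
    by (simp add: power2_eq_square)
  let ?c = "\<lambda>x. complex_of_real (cos (k * (x - a)))" and ?s = "\<lambda>x. complex_of_real (sin (k * (x - a)))"
  \<comment> \<open>Variation of constants: the amplitudes of the wave that osculates \<open>u\<close> at \<open>x\<close> do not
      depend on \<open>x\<close>.\<close>
  define p where "p x = ?c x * u x - ?s x * v x" for x
  define q where "q x = ?s x * u x + ?c x * v x" for x
  have const: "g x = g a" if "x \<in> {a..b}" and
    g: "\<And>x. x \<in> {a..b} \<Longrightarrow> (g has_vector_derivative 0) (at x within {a..b})" for g :: "real \<Rightarrow> complex" and x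
  proof -
    have "\<exists>c. \<forall>x\<in>{a..b}. g x = c"
      by (rule has_derivative_zero_constant) (use g in \<open>auto simp: has_vector_derivative_def\<close>)
    then show ?thesis using that(1) \<open>a \<le> b\<close> by fastforce
  qed
  have dc: "(?c has_vector_derivative - of_real (k * sin (k * (x - a)))) (at x within S)" for x S
    using wave_derivative[of k 1 0 a x S] by (simp add: wave_def)
  have ds: "(?s has_vector_derivative of_real (k * cos (k * (x - a)))) (at x within S)" for x S
    using wave_derivative[of k 0 1 a x S] by (simp add: wave_def)
  have p: "p x = u a" if "x \<in> {a..b}" for x
  proof -
    have "(p has_vector_derivative 0) (at x within {a..b})" if "x \<in> {a..b}" for x
    proof -
      have "(p has_vector_derivative (?c x * (of_real k * v x) + - of_real (k * sin (k * (x - a))) * u x)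
        - (?s x * - (of_real k * u x) + of_real (k * cos (k * (x - a))) * v x)) (at x within {a..b})"
        unfolding p_def
        by (intro has_vector_derivative_diff has_vector_derivative_mult du[OF that] dv[OF that] dc ds)
      then show ?thesis by (simp add: algebra_simps)
    qed
    from const[OF that this] show ?thesis by (simp add: p_def)
  qed
  have q: "q x = v a" if "x \<in> {a..b}" for x
  proof -
    have "(q has_vector_derivative 0) (at x within {a..b})" if "x \<in> {a..b}" for x
    proof -
      have "(q has_vector_derivative (?s x * (of_real k * v x) + of_real (k * cos (k * (x - a))) * u x)
        + (?c x * - (of_real k * u x) + - of_real (k * sin (k * (x - a))) * v x)) (at x within {a..b})"
        unfolding q_def
        by (intro has_vector_derivative_add has_vector_derivative_mult du[OF that] dv[OF that] dc ds)
      then show ?thesis by (simp add: algebra_simps)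
    qed
    from const[OF that this] show ?thesis by (simp add: q_def)
  qed
  have "u x = wave k (u a) (v a) (x - a)" if "x \<in> {a..b}" for x
  proof -
    have "?c x * ?c x + ?s x * ?s x = 1"
      by (metis of_real_1 of_real_add of_real_mult sin_cos_squared_add3)
    moreover have "wave k (p x) (q x) (x - a) = (?c x * ?c x + ?s x * ?s x) * u x"
      unfolding wave_def p_def q_def by (simp add: algebra_simps)
    ultimately show ?thesis using p[OF that] q[OF that] by simp
  qed
  then show ?thesis by (rule that)
qed

section \<open>Eigenfunctions as boundary data\<close>

text \<open>
  The relation between the value \<open>v\<close> and the normal derivative \<open>k n\<close> of a wave at one end of an edge
  and the value \<open>w\<close> and the normal derivative \<open>k m\<close> at the other, where \<open>\<phi>\<close> is \<open>k\<close> times the length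
  of the edge. As both normal derivatives point into the edge, the relation is a reflection rather
  than a rotation, and so does not depend on the direction in which the edge is traversed.
\<close>

definition edge_flow :: "real \<Rightarrow> 'a::real_field \<Rightarrow> 'a \<Rightarrow> 'a \<Rightarrow> 'a \<Rightarrow> bool" where
  "edge_flow \<phi> v n w m \<longleftrightarrow>
     w = of_real (cos \<phi>) * v + of_real (sin \<phi>) * n \<and> m = of_real (sin \<phi>) * v - of_real (cos \<phi>) * n"

lemma edge_flow_reverse:
  assumes "edge_flow \<phi> v n w m"
  shows "edge_flow \<phi> w m v n"
proof -
  let ?c = "of_real (cos \<phi>) :: 'a" and ?s = "of_real (sin \<phi>) :: 'a"
  have "?c * ?c + ?s * ?s = 1"
    by (metis of_real_1 of_real_add of_real_mult sin_cos_squared_add3)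
  moreover have "?c * w + ?s * m = (?c * ?c + ?s * ?s) * v" "?s * w - ?c * m = (?c * ?c + ?s * ?s) * n"
    using assms unfolding edge_flow_def by (auto simp: ring_distribs mult_ac)
  ultimately show ?thesis by (simp add: edge_flow_def)
qed

text \<open>
  On each edge only the data at the left endpoint, which has index \<open>2 j - 1\<close>, are read off; the data
  at the right endpoint are tied to them by \<open>edge_flow\<close>.
\<close>

definition wave_gfun :: "metric_graph \<Rightarrow> real \<Rightarrow> (nat \<Rightarrow> complex) \<Rightarrow> (nat \<Rightarrow> complex) \<Rightarrow> gfun" where
  "wave_gfun \<Gamma> k V N = (\<lambda>j x. if j \<in> {1..n_edges \<Gamma>} \<and> x \<in> edge \<Gamma> j
     then wave k (V (2*j - 1)) (N (2*j - 1)) (x - pt \<Gamma> (2*j - 1)) else 0)"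

lemma endpoint_edge_simps [simp]:
  "1 \<le> j \<Longrightarrow> endpoint_edge (2*j - Suc 0) = j" "endpoint_edge (2*j) = j"
  by (auto simp: endpoint_edge_def)

lemma endpoint_cases:
  fixes i n :: nat
  assumes "i \<in> {1..2*n}"
  obtains j where "j \<in> {1..n}" "i = 2*j - 1" | j where "j \<in> {1..n}" "i = 2*j"
proof (cases "even i")
  case True
  then show ?thesis using assms that(2)[of "i div 2"] by auto
next
  case False
  then show ?thesis using assms that(1)[of "(i + 1) div 2"] by (auto elim!: oddE)
qed

lemma wave_endpoint_data:
  assumes "wf_graph \<Gamma>" "j \<in> {1..n_edges \<Gamma>}"
    and f: "\<And>x. x \<in> edge \<Gamma> j \<Longrightarrow> f j x = wave k A B (x - pt \<Gamma> (2*j - 1))"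
  shows "value_at \<Gamma> f (2*j - 1) = A" "normal_deriv \<Gamma> f (2*j - 1) = of_real k * B"
    "value_at \<Gamma> f (2*j) = wave k A B (edge_length \<Gamma> j)"
    "normal_deriv \<Gamma> f (2*j) = - (of_real k * wave k B (- A) (edge_length \<Gamma> j))"
proof -
  have lt: "pt \<Gamma> (2*j - 1) < pt \<Gamma> (2*j)" and j: "1 \<le> j" using assms by (auto simp: wf_graph_def)
  have "(f j has_vector_derivative of_real k * wave k B (- A) (x - pt \<Gamma> (2*j - 1))) (at x within edge \<Gamma> j)"
    if "x \<in> edge \<Gamma> j" for x
    by (rule has_vector_derivative_transform[OF that _ wave_derivative]) (simp add: f)
  then have d: "vector_derivative (f j) (at x within edge \<Gamma> j) = of_real k * wave k B (- A) (x - pt \<Gamma> (2*j - 1))"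
    if "x \<in> edge \<Gamma> j" for x
    using that vector_derivative_within_closed_interval[OF lt] unfolding edge_def by blast
  have e: "pt \<Gamma> (2*j - 1) \<in> edge \<Gamma> j" "pt \<Gamma> (2*j) \<in> edge \<Gamma> j" using lt by (auto simp: edge_def)
  have odd: "odd (2*j - 1)" using j by auto
  show "value_at \<Gamma> f (2*j - 1) = A" "normal_deriv \<Gamma> f (2*j - 1) = of_real k * B"
    "value_at \<Gamma> f (2*j) = wave k A B (edge_length \<Gamma> j)"
    "normal_deriv \<Gamma> f (2*j) = - (of_real k * wave k B (- A) (edge_length \<Gamma> j))"
    using j odd d[OF e(1)] d[OF e(2)] f[OF e(1)] f[OF e(2)]
    by (simp_all add: value_at_def normal_deriv_def edge_length_def wave_def)
qed

lemma wave_gfun_endpoint_data: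
  assumes "wf_graph \<Gamma>" "i \<in> {1..2 * n_edges \<Gamma>}"
    and flow: "\<And>j. j \<in> {1..n_edges \<Gamma>} \<Longrightarrow>
      edge_flow (k * edge_length \<Gamma> j) (V (2*j - 1)) (N (2*j - 1)) (V (2*j)) (N (2*j))"
  shows "value_at \<Gamma> (wave_gfun \<Gamma> k V N) i = V i"
    and "normal_deriv \<Gamma> (wave_gfun \<Gamma> k V N) i = of_real k * N i"
proof -
  have w: "wave_gfun \<Gamma> k V N j x = wave k (V (2*j - 1)) (N (2*j - 1)) (x - pt \<Gamma> (2*j - 1))"
    if "j \<in> {1..n_edges \<Gamma>}" "x \<in> edge \<Gamma> j" for j x
    using that by (simp add: wave_gfun_def)
  have "value_at \<Gamma> (wave_gfun \<Gamma> k V N) i = V i \<and>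
    normal_deriv \<Gamma> (wave_gfun \<Gamma> k V N) i = of_real k * N i"
    using assms(2)
  proof (cases rule: endpoint_cases)
    case (1 j)
    then show ?thesis
      using wave_endpoint_data(1,2)[where f = "wave_gfun \<Gamma> k V N", OF assms(1) 1(1) w[OF 1(1)]] by simp
  next
    case (2 j)
    then show ?thesis using wave_endpoint_data(3,4)[where f = "wave_gfun \<Gamma> k V N", OF assms(1) 2(1) w[OF 2(1)]] flow[OF 2(1)]
      by (simp add: edge_flow_def wave_def ring_distribs)
  qed
  then show "value_at \<Gamma> (wave_gfun \<Gamma> k V N) i = V i"
    "normal_deriv \<Gamma> (wave_gfun \<Gamma> k V N) i = of_real k * N i" by auto
qed

text \<open>
  Like the data in \<open>edge_flow\<close>, \<open>N\<close> consists of normal derivatives divided by \<open>k\<close>.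
\<close>

definition vertex_conditions ::
  "metric_graph \<Rightarrow> (nat \<Rightarrow> real) \<Rightarrow> real \<Rightarrow> (nat \<Rightarrow> complex) \<Rightarrow> (nat \<Rightarrow> complex) \<Rightarrow> bool" where
  "vertex_conditions \<Gamma> \<alpha> k V N \<longleftrightarrow> (\<forall>m\<in>{1..n_verts \<Gamma>}. \<exists>v. (\<forall>i\<in>vert \<Gamma> m. V i = v) \<and>
     of_real k * (\<Sum>i\<in>vert \<Gamma> m. N i) = of_real (\<alpha> m) * v)"

lemma wf_graph_vert_subset: "wf_graph \<Gamma> \<Longrightarrow> m \<in> {1..n_verts \<Gamma>} \<Longrightarrow> vert \<Gamma> m \<subseteq> {1..2 * n_edges \<Gamma>}"
  unfolding wf_graph_def by (metis UN_upper)

text \<open>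
  This lemma and the next reduce the eigenvalue problem to linear algebra: eigenfunctions for
  \<open>k\<^sup>2\<close> correspond to endpoint data that satisfy the flow relation on every edge and the matching
  conditions at every vertex.
\<close>

lemma wave_gfun_in_eigenspace:
  assumes wf: "wf_graph \<Gamma>"
    and flow: "\<And>j. j \<in> {1..n_edges \<Gamma>} \<Longrightarrow>
      edge_flow (k * edge_length \<Gamma> j) (V (2*j - 1)) (N (2*j - 1)) (V (2*j)) (N (2*j))"
    and vert: "vertex_conditions \<Gamma> \<alpha> k V N"
  shows "wave_gfun \<Gamma> k V N \<in> eigenspace (laplacian \<Gamma> \<alpha>) (of_real (k\<^sup>2))"
proof -
  let ?f = "wave_gfun \<Gamma> k V N"
  have supp: "supported \<Gamma> ?f" by (simp add: supported_def wave_gfun_def)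
  have le: "pt \<Gamma> (2*j - 1) \<le> pt \<Gamma> (2*j)" if "j \<in> {1..n_edges \<Gamma>}" for j
    using wf that by (auto simp: wf_graph_def less_imp_le)
  have sd: "second_deriv (pt \<Gamma> (2*j - 1)) (pt \<Gamma> (2*j)) (?f j) (\<lambda>x. - (of_real (k\<^sup>2) * ?f j x))"
    if "j \<in> {1..n_edges \<Gamma>}" for j
    by (rule wave_second_deriv[OF le[OF that]]) (use that in \<open>simp add: wave_gfun_def edge_def\<close>)
  have "?f \<in> W22 \<Gamma>" using supp sd unfolding W22_def by blast
  moreover have "gscale (of_real (k\<^sup>2)) ?f \<in> L2 \<Gamma>"
  proof -
    have "L2_on (edge \<Gamma> j) (gscale (of_real (k\<^sup>2)) ?f j)" if j: "j \<in> {1..n_edges \<Gamma>}" for j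
      unfolding edge_def
    proof (rule continuous_on_imp_L2_on)
      let ?w = "\<lambda>x. of_real (k\<^sup>2) * wave k (V (2*j - 1)) (N (2*j - 1)) (x - pt \<Gamma> (2*j - 1))"
      have "continuous_on {pt \<Gamma> (2*j - 1)..pt \<Gamma> (2*j)} ?w"
        unfolding wave_def by (intro continuous_intros)
      then show "continuous_on {pt \<Gamma> (2*j - 1)..pt \<Gamma> (2*j)} (gscale (of_real (k\<^sup>2)) ?f j)"
        by (rule continuous_on_cong[THEN iffD1, rotated -1])
          (use j in \<open>auto simp: gscale_def wave_gfun_def edge_def\<close>)
    qed
    then show ?thesis using supp by (auto simp: L2_def supported_def gscale_def)
  qed
  moreover have "\<exists>v. (\<forall>i\<in>vert \<Gamma> m. value_at \<Gamma> ?f i = v) \<and>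
      (\<Sum>i\<in>vert \<Gamma> m. normal_deriv \<Gamma> ?f i) = of_real (\<alpha> m) * v" if m: "m \<in> {1..n_verts \<Gamma>}" for m
  proof -
    have i: "value_at \<Gamma> ?f i = V i" "normal_deriv \<Gamma> ?f i = of_real k * N i" if "i \<in> vert \<Gamma> m" for i
      using wave_gfun_endpoint_data[of \<Gamma> i k V N, OF wf _ flow] wf_graph_vert_subset[OF wf m] that by auto
    obtain v where "\<forall>i\<in>vert \<Gamma> m. V i = v" "of_real k * (\<Sum>i\<in>vert \<Gamma> m. N i) = of_real (\<alpha> m) * v"
      using vert m unfolding vertex_conditions_def by blast
    then show ?thesis using i by (intro exI[of _ v]) (simp add: sum_distrib_left)
  qed
  ultimately show ?thesis
    using sd unfolding eigenspace_def laplacian_def laplacian_dom_def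
    by (simp add: gscale_def)
qed

lemma eigenspace_imp_wave_gfun:
  assumes wf: "wf_graph \<Gamma>" and k: "k > 0"
    and f: "f \<in> eigenspace (laplacian \<Gamma> \<alpha>) (of_real (k\<^sup>2))"
  obtains V N where "f = wave_gfun \<Gamma> k V N" "vertex_conditions \<Gamma> \<alpha> k V N"
    "\<And>j. j \<in> {1..n_edges \<Gamma>} \<Longrightarrow>
      edge_flow (k * edge_length \<Gamma> j) (V (2*j - 1)) (N (2*j - 1)) (V (2*j)) (N (2*j))"
proof -
  define V where "V = value_at \<Gamma> f"
  define N where "N i = normal_deriv \<Gamma> f i / of_real k" for i
  have dom: "f \<in> laplacian_dom \<Gamma> \<alpha>" and
    sd: "\<And>j. j \<in> {1..n_edges \<Gamma>} \<Longrightarrow>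
      second_deriv (pt \<Gamma> (2*j - 1)) (pt \<Gamma> (2*j)) (f j) (\<lambda>x. - (of_real (k\<^sup>2) * f j x))"
    using f by (auto simp: eigenspace_def laplacian_def gscale_def)
  have wave: "f j x = wave k (V (2*j - 1)) (N (2*j - 1)) (x - pt \<Gamma> (2*j - 1))"
    and flow: "edge_flow (k * edge_length \<Gamma> j) (V (2*j - 1)) (N (2*j - 1)) (V (2*j)) (N (2*j))"
    if j: "j \<in> {1..n_edges \<Gamma>}" and "x \<in> edge \<Gamma> j \<or> x = pt \<Gamma> (2*j)" for j x
  proof -
    have le: "pt \<Gamma> (2*j - 1) \<le> pt \<Gamma> (2*j)" using wf j by (auto simp: wf_graph_def less_imp_le)
    obtain A B where AB: "\<And>x. x \<in> edge \<Gamma> j \<Longrightarrow> f j x = wave k A B (x - pt \<Gamma> (2*j - 1))"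
      using second_deriv_imp_wave[OF le k sd[OF j]] unfolding edge_def by blast
    note data = wave_endpoint_data[where f = f, OF wf j AB]
    have "V (2*j - 1) = A" "N (2*j - 1) = B" "V (2*j) = wave k A B (edge_length \<Gamma> j)"
      "N (2*j) = - wave k B (- A) (edge_length \<Gamma> j)"
      using data k by (simp_all add: V_def N_def)
    then show "f j x = wave k (V (2*j - 1)) (N (2*j - 1)) (x - pt \<Gamma> (2*j - 1))"
      "edge_flow (k * edge_length \<Gamma> j) (V (2*j - 1)) (N (2*j - 1)) (V (2*j)) (N (2*j))"
      using AB that(2) le by (auto simp: edge_flow_def wave_def edge_def)
  qed
  have "f j x = wave_gfun \<Gamma> k V N j x" for j x
    using dom wave[of j x] by (auto simp: laplacian_dom_def W22_def supported_def wave_gfun_def)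
  then have "f = wave_gfun \<Gamma> k V N" by (intro ext)
  moreover have "vertex_conditions \<Gamma> \<alpha> k V N"
    using dom k unfolding vertex_conditions_def laplacian_dom_def V_def N_def
    by (simp add: sum_divide_distrib[symmetric])
  ultimately show ?thesis using flow by (intro that) auto
qed

text \<open>
  Two different eigenfunctions for \<open>z\<close> both solve the resolvent equation with right-hand side 0.
\<close>

lemma eigenvalue_in_spectrum:
  assumes "f \<in> eigenspace T z" "g \<in> eigenspace T z" "f \<noteq> g"
  shows "z \<in> spectrum \<Gamma> T"
proof -
  have zero: "(0 :: gfun) \<in> L2 \<Gamma>"
    by (auto simp: L2_def supported_def L2_on_def zero_fun_def)
  show ?thesis
  proof (rule ccontr)
    assume "z \<notin> spectrum \<Gamma> T"
    then have "\<exists>!f. (f, gscale z f + 0) \<in> T"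
      using zero unfolding spectrum_def resolvent_set_def by blast
    with assms show False by (auto simp: eigenspace_def)
  qed
qed

section \<open>Shooting along the chain\<close>

text \<open>
  The chain traversed from the first vertex to the last: the \<open>j\<close>-th edge is entered at the endpoint
  \<open>a j\<close> and left at \<open>b j\<close>, whichever of the two is the left endpoint of the interval.
\<close>

locale oriented_chain =
  fixes \<Gamma> :: metric_graph and a b :: "nat \<Rightarrow> nat"
  assumes wf: "wf_graph \<Gamma>" and edges: "n_edges \<Gamma> = 3" and verts: "n_verts \<Gamma> = 4"
    and orient: "j \<in> {1..3} \<Longrightarrow> (a j = 2*j - 1 \<and> b j = 2*j) \<or> (a j = 2*j \<and> b j = 2*j - 1)"
    and vert: "vert \<Gamma> 1 = {a 1}" "vert \<Gamma> 2 = {b 1, a 2}" "vert \<Gamma> 3 = {b 2, a 3}" "vert \<Gamma> 4 = {b 3}"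

lemma chain_A4_oriented:
  assumes "chain_A4 \<Gamma>"
  obtains a b where "oriented_chain \<Gamma> a b"
proof -
  have wf: "wf_graph \<Gamma>" and n: "n_edges \<Gamma> = 3" "n_verts \<Gamma> = 4"
    using assms by (auto simp: chain_A4_def)
  have "joins \<Gamma> j j (j + 1)" if "j \<in> {1..3}" for j
  proof -
    have "j = 1 \<or> j = 2 \<or> j = 3" using that by auto
    then show ?thesis using assms by (auto simp: chain_A4_def eval_nat_numeral)
  qed
  then have "\<exists>x y. ((x = 2*j - 1 \<and> y = 2*j) \<or> (x = 2*j \<and> y = 2*j - 1)) \<and> x \<in> vert \<Gamma> j \<and> y \<in> vert \<Gamma> (j + 1)"
    if "j \<in> {1..3}" for j
    using that unfolding joins_def by blast
  then obtain a b where
    ab: "\<And>j. j \<in> {1..3} \<Longrightarrow> (a j = 2*j - 1 \<and> b j = 2*j) \<or> (a j = 2*j \<and> b j = 2*j - 1)"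
    and v: "\<And>j. j \<in> {1..3} \<Longrightarrow> a j \<in> vert \<Gamma> j \<and> b j \<in> vert \<Gamma> (j + 1)"
    by metis
  have v': "a 1 \<in> vert \<Gamma> 1" "b 1 \<in> vert \<Gamma> 2" "a 2 \<in> vert \<Gamma> 2" "b 2 \<in> vert \<Gamma> 3"
    "a 3 \<in> vert \<Gamma> 3" "b 3 \<in> vert \<Gamma> 4"
    using v[of 1] v[of 2] v[of 3] by (auto simp: numeral_2_eq_2 numeral_3_eq_3 eval_nat_numeral)
  have cover: "x \<in> {a 1, b 1, a 2, b 2, a 3, b 3}" if "x \<in> vert \<Gamma> m" "m \<in> {1..4}" for x m
  proof -
    have "x \<in> {1..2*3}" using wf_graph_vert_subset[OF wf, of m] that n by auto
    then have "x \<in> {1, 2, 3, 4, 5, 6}" by auto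
    then show ?thesis using ab[of 1] ab[of 2] ab[of 3] by auto
  qed
  have disj: "m = m'" if "x \<in> vert \<Gamma> m" "x \<in> vert \<Gamma> m'" "m \<in> {1..4}" "m' \<in> {1..4}" for x m m'
  proof (rule ccontr)
    assume "m \<noteq> m'"
    moreover have "disjoint_family_on (vert \<Gamma>) {1..4}" using wf n by (simp add: wf_graph_def)
    ultimately have "vert \<Gamma> m \<inter> vert \<Gamma> m' = {}" using that unfolding disjoint_family_on_def by blast
    then show False using that by auto
  qed
  have "x \<in> {a 1}" if x: "x \<in> vert \<Gamma> 1" for x
    using cover[OF x] disj[OF x] v' by force
  moreover have "x \<in> {b 1, a 2}" if x: "x \<in> vert \<Gamma> 2" for x
    using cover[OF x] disj[OF x] v' by force
  moreover have "x \<in> {b 2, a 3}" if x: "x \<in> vert \<Gamma> 3" for x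
    using cover[OF x] disj[OF x] v' by force
  moreover have "x \<in> {b 3}" if x: "x \<in> vert \<Gamma> 4" for x
    using cover[OF x] disj[OF x] v' by force
  ultimately have "vert \<Gamma> 1 = {a 1}" "vert \<Gamma> 2 = {b 1, a 2}" "vert \<Gamma> 3 = {b 2, a 3}" "vert \<Gamma> 4 = {b 3}"
    using v' by blast+
  then have "oriented_chain \<Gamma> a b" using wf n ab by unfold_locales auto
  then show ?thesis by (rule that)
qed

text \<open>
  Value and normalised normal derivative at the start of edge \<open>j + 1\<close> of the solution that has value 1
  at the first vertex and satisfies the matching conditions at the vertices \<open>1, ..., j + 1\<close>. Here
  \<open>s m\<close> is the coupling constant of vertex \<open>m\<close> divided by \<open>k\<close>, and \<open>\<phi> j\<close> is \<open>k\<close> times the length of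
  edge \<open>j\<close>.
\<close>

primrec shoot :: "(nat \<Rightarrow> real) \<Rightarrow> (nat \<Rightarrow> real) \<Rightarrow> nat \<Rightarrow> real \<times> real" where
  "shoot s \<phi> 0 = (1, s 1)"
| "shoot s \<phi> (Suc j) =
    (let v = fst (shoot s \<phi> j); n = snd (shoot s \<phi> j);
         w = cos (\<phi> (Suc j)) * v + sin (\<phi> (Suc j)) * n
     in (w, s (Suc (Suc j)) * w - (sin (\<phi> (Suc j)) * v - cos (\<phi> (Suc j)) * n)))"

text \<open>
  No edge begins at the fourth vertex, so the derivative that a further edge would have to carry
  there is the amount by which the solution violates the matching condition.
\<close>

definition secular :: "(nat \<Rightarrow> real) \<Rightarrow> (nat \<Rightarrow> real) \<Rightarrow> real" where
  "secular s \<phi> = snd (shoot s \<phi> 3)"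

text \<open>
  The case of the last vertex is covered as well, with \<open>n = 0\<close>.
\<close>

lemma shoot_step:
  fixes c :: complex
  assumes "edge_flow (\<phi> (Suc j)) (c * of_real (fst (shoot s \<phi> j))) (c * of_real (snd (shoot s \<phi> j))) w m"
    and "m + n = of_real (s (Suc (Suc j))) * w"
  shows "w = c * of_real (fst (shoot s \<phi> (Suc j)))" "n = c * of_real (snd (shoot s \<phi> (Suc j)))"
proof -
  show w: "w = c * of_real (fst (shoot s \<phi> (Suc j)))"
    using assms(1) by (simp add: edge_flow_def Let_def algebra_simps)
  have "n = of_real (s (Suc (Suc j))) * w - m" using assms(2) by (simp add: algebra_simps)
  then show "n = c * of_real (snd (shoot s \<phi> (Suc j)))"
    unfolding w using assms(1) by (simp add: edge_flow_def Let_def ring_distribs mult_ac)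
qed

context oriented_chain
begin

lemma vertex_conditions_chain:
  assumes "k > 0"
  shows "vertex_conditions \<Gamma> \<alpha> k V N \<longleftrightarrow>
    N (a 1) = of_real (\<alpha> 1 / k) * V (a 1) \<and>
    V (b 1) = V (a 2) \<and> N (b 1) + N (a 2) = of_real (\<alpha> 2 / k) * V (b 1) \<and>
    V (b 2) = V (a 3) \<and> N (b 2) + N (a 3) = of_real (\<alpha> 3 / k) * V (b 2) \<and>
    N (b 3) = of_real (\<alpha> 4 / k) * V (b 3)"
proof -
  have set: "{1..n_verts \<Gamma>} = {1, 2, 3, 4}" by (auto simp: verts)
  have ne: "b 1 \<noteq> a 2" "b 2 \<noteq> a 3" using orient[of 1] orient[of 2] orient[of 3] by auto
  show ?thesis
    unfolding vertex_conditions_def set using ne \<open>k > 0\<close>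
    by (auto simp: vert vert(1)[unfolded One_nat_def] field_simps)
qed

lemma edge_flow_oriented:
  assumes "j \<in> {1..3}"
  shows "edge_flow \<phi> (V (2*j - 1)) (N (2*j - 1)) (V (2*j)) (N (2*j)) \<longleftrightarrow>
    edge_flow \<phi> (V (a j)) (N (a j)) (V (b j)) (N (b j))"
  using orient[OF assms] edge_flow_reverse by metis

definition shoot_values :: "(nat \<Rightarrow> real) \<Rightarrow> (nat \<Rightarrow> real) \<Rightarrow> nat \<Rightarrow> complex" where
  "shoot_values s \<phi> i = (let j = endpoint_edge i in
     of_real (fst (shoot s \<phi> (if i = a j then j - 1 else j))))"

definition shoot_derivs :: "(nat \<Rightarrow> real) \<Rightarrow> (nat \<Rightarrow> real) \<Rightarrow> nat \<Rightarrow> complex" where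
  "shoot_derivs s \<phi> i = (let j = endpoint_edge i in of_real (if i = a j then snd (shoot s \<phi> (j - 1))
     else sin (\<phi> j) * fst (shoot s \<phi> (j - 1)) - cos (\<phi> j) * snd (shoot s \<phi> (j - 1))))"

lemma endpoint_edge_ab: "j \<in> {1..3} \<Longrightarrow> endpoint_edge (a j) = j" "j \<in> {1..3} \<Longrightarrow> endpoint_edge (b j) = j"
  using orient[of j] by auto

lemma shoot_data_start:
  assumes "j \<in> {1..3}"
  shows "shoot_values s \<phi> (a j) = of_real (fst (shoot s \<phi> (j - 1)))"
    "shoot_derivs s \<phi> (a j) = of_real (snd (shoot s \<phi> (j - 1)))"
  by (simp_all add: shoot_values_def shoot_derivs_def endpoint_edge_ab[OF assms] Let_def)

lemma shoot_data_end:
  assumes "j \<in> {1..3}"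
  shows "shoot_values s \<phi> (b j) = of_real (fst (shoot s \<phi> j))"
    "shoot_derivs s \<phi> (b j) =
      of_real (sin (\<phi> j) * fst (shoot s \<phi> (j - 1)) - cos (\<phi> j) * snd (shoot s \<phi> (j - 1)))"
proof -
  have "b j \<noteq> a j" using orient[OF assms] assms by auto
  then show "shoot_values s \<phi> (b j) = of_real (fst (shoot s \<phi> j))"
    "shoot_derivs s \<phi> (b j) =
      of_real (sin (\<phi> j) * fst (shoot s \<phi> (j - 1)) - cos (\<phi> j) * snd (shoot s \<phi> (j - 1)))"
    by (simp_all add: shoot_values_def shoot_derivs_def endpoint_edge_ab[OF assms] Let_def)
qed

lemma shoot_vertex:
  "shoot_derivs s \<phi> (b (Suc j)) + of_real (snd (shoot s \<phi> (Suc j))) =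
    of_real (s (Suc (Suc j))) * shoot_values s \<phi> (b (Suc j))" if "j < 3"
  using that by (simp add: shoot_data_end Let_def)

definition shoot_gfun :: "real \<Rightarrow> (nat \<Rightarrow> real) \<Rightarrow> gfun" where
  "shoot_gfun k \<alpha> = wave_gfun \<Gamma> k
     (shoot_values (\<lambda>m. \<alpha> m / k) (\<lambda>j. k * edge_length \<Gamma> j))
     (shoot_derivs (\<lambda>m. \<alpha> m / k) (\<lambda>j. k * edge_length \<Gamma> j))"

lemma gscale_wave_gfun: "gscale c (wave_gfun \<Gamma> k V N) = wave_gfun \<Gamma> k (\<lambda>i. c * V i) (\<lambda>i. c * N i)"
  by (auto simp: gscale_def wave_gfun_def wave_def fun_eq_iff algebra_simps)

lemma shoot_edge_flow:
  assumes "j \<in> {1..3}"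
  shows "edge_flow (\<phi> j) (c * shoot_values s \<phi> (a j)) (c * shoot_derivs s \<phi> (a j))
    (c * shoot_values s \<phi> (b j)) (c * shoot_derivs s \<phi> (b j))"
proof -
  obtain i where "j = Suc i" using assms by (cases j) auto
  then show ?thesis
    using assms by (simp add: shoot_data_start shoot_data_end edge_flow_def Let_def algebra_simps)
qed

lemma shoot_gfun_in_eigenspace:
  assumes k: "k > 0" and sec: "secular (\<lambda>m. \<alpha> m / k) (\<lambda>j. k * edge_length \<Gamma> j) = 0"
  shows "gscale c (shoot_gfun k \<alpha>) \<in> eigenspace (laplacian \<Gamma> \<alpha>) (of_real (k\<^sup>2))"
proof -
  let ?s = "\<lambda>m. \<alpha> m / k" and ?p = "\<lambda>j. k * edge_length \<Gamma> j"
  let ?V = "\<lambda>i. c * shoot_values ?s ?p i" and ?N = "\<lambda>i. c * shoot_derivs ?s ?p i"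
  have "wave_gfun \<Gamma> k ?V ?N \<in> eigenspace (laplacian \<Gamma> \<alpha>) (of_real (k\<^sup>2))"
  proof (rule wave_gfun_in_eigenspace[OF wf])
    show "edge_flow (k * edge_length \<Gamma> j) (?V (2*j - 1)) (?N (2*j - 1)) (?V (2*j)) (?N (2*j))"
      if "j \<in> {1..n_edges \<Gamma>}" for j
      using shoot_edge_flow[of j ?p c ?s] edge_flow_oriented[of j "?p j" ?V ?N] that by (simp add: edges)
    have v: "?N (b (Suc j)) + c * of_real (snd (shoot ?s ?p (Suc j))) =
      of_real (?s (Suc (Suc j))) * ?V (b (Suc j))" if "j < 3" for j
      using shoot_vertex[OF that, of ?s ?p] by (metis distrib_left mult.left_commute)
    have "snd (shoot ?s ?p 3) = 0" using sec by (simp add: secular_def)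
    then show "vertex_conditions \<Gamma> \<alpha> k ?V ?N"
      using v[of 0] v[of 1] v[of 2]
      by (simp add: vertex_conditions_chain[OF k] shoot_data_start shoot_data_end(1) numeral_3_eq_3 numeral_2_eq_2
          del: shoot.simps(2)) (simp add: eval_nat_numeral)
  qed
  then show ?thesis by (simp add: gscale_wave_gfun shoot_gfun_def)
qed

text \<open>
  An eigenfunction is determined by its value \<open>c\<close> at the first vertex, since the matching condition
  there provides the derivative and every further step is forced. The last matching condition is
  the second conclusion.
\<close>

lemma eigenfunction_multiple_of_shoot:
  assumes k: "k > 0" and f: "f \<in> eigenspace (laplacian \<Gamma> \<alpha>) (of_real (k\<^sup>2))"
  obtains c where "f = gscale c (shoot_gfun k \<alpha>)"
    "c * of_real (secular (\<lambda>m. \<alpha> m / k) (\<lambda>j. k * edge_length \<Gamma> j)) = 0"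
proof -
  let ?s = "\<lambda>m. \<alpha> m / k" and ?p = "\<lambda>j. k * edge_length \<Gamma> j"
  obtain V N where fw: "f = wave_gfun \<Gamma> k V N" and vc: "vertex_conditions \<Gamma> \<alpha> k V N"
    and flow: "\<And>j. j \<in> {1..n_edges \<Gamma>} \<Longrightarrow>
      edge_flow (k * edge_length \<Gamma> j) (V (2*j - 1)) (N (2*j - 1)) (V (2*j)) (N (2*j))"
    using eigenspace_imp_wave_gfun[OF wf k f] by blast
  note vc = vc[unfolded vertex_conditions_chain[OF k]]
  have flow': "edge_flow (?p j) (V (a j)) (N (a j)) (V (b j)) (N (b j))" if "j \<in> {1..3}" for j
    using flow[of j] edge_flow_oriented[OF that, of "?p j" V N] that by (simp add: edges)
  define c where "c = V (a 1)"
  have 0: "V (a 1) = c * of_real (fst (shoot ?s ?p 0))" "N (a 1) = c * of_real (snd (shoot ?s ?p 0))"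
    using vc by (simp_all add: c_def)
  have 1: "V (b 1) = c * of_real (fst (shoot ?s ?p 1))" "V (a 2) = c * of_real (fst (shoot ?s ?p 1))"
      "N (a 2) = c * of_real (snd (shoot ?s ?p 1))"
    using shoot_step[of ?p 0 c ?s "V (b 1)" "N (b 1)" "N (a 2)"] flow'[of 1] vc
    unfolding 0 by (simp_all add: numeral_2_eq_2 del: shoot.simps)
  have 2: "V (b 2) = c * of_real (fst (shoot ?s ?p 2))" "V (a 3) = c * of_real (fst (shoot ?s ?p 2))"
      "N (a 3) = c * of_real (snd (shoot ?s ?p 2))"
    using shoot_step[of ?p 1 c ?s "V (b 2)" "N (b 2)" "N (a 3)"] flow'[of 2] vc
    unfolding 1 by (simp_all add: numeral_2_eq_2 numeral_3_eq_3 del: shoot.simps)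
  have 3: "V (b 3) = c * of_real (fst (shoot ?s ?p 3))" "0 = c * of_real (snd (shoot ?s ?p 3))"
    using shoot_step[of ?p 2 c ?s "V (b 3)" "N (b 3)" 0] flow'[of 3] vc
    unfolding 2 by (simp_all add: eval_nat_numeral del: shoot.simps)
  have start: "V (a j) = c * shoot_values ?s ?p (a j)" "N (a j) = c * shoot_derivs ?s ?p (a j)" if "j \<in> {1..3}" for j
  proof -
    have "j = 1 \<or> j = 2 \<or> j = 3" using that by auto
    then show "V (a j) = c * shoot_values ?s ?p (a j)" "N (a j) = c * shoot_derivs ?s ?p (a j)"
      using 0 1 2 by (auto simp: shoot_data_start simp del: shoot.simps(2))
  qed
  have "V (2*j - 1) = c * shoot_values ?s ?p (2*j - 1) \<and> N (2*j - 1) = c * shoot_derivs ?s ?p (2*j - 1)"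
    if j: "j \<in> {1..3}" for j
  proof -
    have fin: "V (b j) = c * shoot_values ?s ?p (b j)" "N (b j) = c * shoot_derivs ?s ?p (b j)"
      using flow'[OF j] shoot_edge_flow[OF j, of ?p c ?s] start[OF j] by (auto simp: edge_flow_def)
    show ?thesis using orient[OF j] start[OF j] fin by auto
  qed
  then have "f = gscale c (shoot_gfun k \<alpha>)"
    unfolding fw shoot_gfun_def gscale_wave_gfun
    by (auto simp: wave_gfun_def fun_eq_iff edges)
  moreover have "c * of_real (secular ?s ?p) = 0" using 3(2) by (simp add: secular_def)
  ultimately show ?thesis by (rule that)
qed

lemma shoot_gfun_nonzero:
  assumes "k > 0" shows "shoot_gfun k \<alpha> \<noteq> 0"
proof -
  let ?s = "\<lambda>m. \<alpha> m / k" and ?p = "\<lambda>j. k * edge_length \<Gamma> j"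
  have "value_at \<Gamma> (shoot_gfun k \<alpha>) (a 1) = shoot_values ?s ?p (a 1)"
    unfolding shoot_gfun_def
  proof (rule wave_gfun_endpoint_data(1)[OF wf])
    show "a 1 \<in> {1..2 * n_edges \<Gamma>}" using orient[of 1] by (auto simp: edges)
    show "edge_flow (?p j) (shoot_values ?s ?p (2*j - 1)) (shoot_derivs ?s ?p (2*j - 1))
      (shoot_values ?s ?p (2*j)) (shoot_derivs ?s ?p (2*j))" if "j \<in> {1..n_edges \<Gamma>}" for j
      using shoot_edge_flow[of j ?p 1 ?s] edge_flow_oriented[of j "?p j" "shoot_values ?s ?p" "shoot_derivs ?s ?p"]
        that by (simp add: edges)
  qed
  also have "\<dots> = 1" using shoot_data_start(1)[of 1 ?s ?p] by simp
  finally show ?thesis by (auto simp: value_at_def)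
qed

lemma multiplicity_chain:
  assumes k: "k > 0"
  shows "multiplicity (laplacian \<Gamma> \<alpha>) (of_real (k\<^sup>2)) =
    (if secular (\<lambda>m. \<alpha> m / k) (\<lambda>j. k * edge_length \<Gamma> j) = 0 then 1 else 0)"
proof -
  let ?E = "eigenspace (laplacian \<Gamma> \<alpha>) (of_real (k\<^sup>2))" and ?f = "shoot_gfun k \<alpha>"
  interpret vector_space gscale by (rule vector_space_gscale)
  show ?thesis
  proof (cases "secular (\<lambda>m. \<alpha> m / k) (\<lambda>j. k * edge_length \<Gamma> j) = 0")
    case True
    have "?E \<subseteq> span {?f}"
      unfolding span_singleton by (rule subsetI, erule eigenfunction_multiple_of_shoot[OF k]) auto
    moreover have "?f \<in> ?E" using shoot_gfun_in_eigenspace[OF k True, of 1] by simp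
    ultimately have "dim ?E = 1"
      using shoot_gfun_nonzero[OF k, of \<alpha>] by (intro dim_unique[of "{?f}"]) auto
    with True show ?thesis by (simp add: multiplicity_def)
  next
    case False
    have "?E \<subseteq> {0}"
      by (rule subsetI, erule eigenfunction_multiple_of_shoot[OF k]) (use False in auto)
    then have "dim ?E = 0" by (intro dim_unique[of "{}"]) (auto simp: independent_empty)
    with False show ?thesis by (simp add: multiplicity_def)
  qed
qed

lemma chain_eigenvalue_in_spectrum:
  assumes k: "k > 0" and "secular (\<lambda>m. \<alpha> m / k) (\<lambda>j. k * edge_length \<Gamma> j) = 0"
  shows "of_real (k\<^sup>2) \<in> spectrum \<Gamma> (laplacian \<Gamma> \<alpha>)"
proof -
  interpret vector_space gscale by (rule vector_space_gscale)
  show ?thesis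
    by (rule eigenvalue_in_spectrum[OF shoot_gfun_in_eigenspace[OF assms, of 1]
          shoot_gfun_in_eigenspace[OF assms, of 0]])
      (simp add: shoot_gfun_nonzero[OF k])
qed

end

text \<open>
  At a zero of the first secular function the spectra have a common point. It has multiplicity 1 for
  the first operator, hence also for the second, and therefore is an eigenvalue of the second.
\<close>

lemma isospectral_imp_secular_eq_0:
  assumes "chain_A4 \<Gamma>" and iso: "isospectral \<Gamma> (laplacian \<Gamma> \<alpha>) (laplacian \<Gamma> \<alpha>')" and k: "k > 0"
    and sec: "secular (\<lambda>m. \<alpha> m / k) (\<lambda>j. k * edge_length \<Gamma> j) = 0"
  shows "secular (\<lambda>m. \<alpha>' m / k) (\<lambda>j. k * edge_length \<Gamma> j) = 0"
proof -
  obtain a b where "oriented_chain \<Gamma> a b" using chain_A4_oriented[OF assms(1)] .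
  then interpret oriented_chain \<Gamma> a b .
  have "multiplicity (laplacian \<Gamma> \<alpha>) (of_real (k\<^sup>2)) = multiplicity (laplacian \<Gamma> \<alpha>') (of_real (k\<^sup>2))"
    using iso chain_eigenvalue_in_spectrum[OF k sec] unfolding isospectral_def by blast
  then show ?thesis using sec unfolding multiplicity_chain[OF k] by (simp split: if_splits)
qed

section \<open>Simultaneous Diophantine approximation\<close>

text \<open>
  Kronecker's theorem provides a real \<open>t\<close> without control of its size or sign. Adding a large multiple
  of a simultaneous almost-period, which exists by Dirichlet's theorem, makes \<open>t\<close> as large as desired.
\<close>

lemma Kronecker_rationally_independent:
  fixes l \<theta> :: "nat \<Rightarrow> real"
  assumes indep: "rationally_independent {1..n} l" and "\<epsilon> > 0"
  obtains t h where "t > K" "\<And>j. j \<in> {1..n} \<Longrightarrow> \<bar>t * l j - 2 * pi * of_int (h j) - \<theta> j\<bar> < \<epsilon>"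
proof -
  have indep: "c j = 0" if "(\<Sum>j\<in>{1..n}. of_rat (c j) * l j) = 0" "j \<in> {1..n}" for c j
    using indep that unfolding rationally_independent_def by blast
  define \<eta> where "\<eta> i = l (Suc i)" for i
  define \<delta> where "\<delta> = \<epsilon> / (2 * pi)"
  have "\<delta> > 0" using \<open>\<epsilon> > 0\<close> by (simp add: \<delta>_def)
  have inj: "inj_on \<eta> {..<n}"
  proof (rule inj_onI, rule ccontr)
    fix i i' assume i: "i \<in> {..<n}" "i' \<in> {..<n}" "\<eta> i = \<eta> i'" "i \<noteq> i'"
    define c where "c j = (if j = Suc i then 1 else if j = Suc i' then - 1 else 0 :: rat)" for j
    have "(\<Sum>j\<in>{1..n}. of_rat (c j) * l j) = (\<Sum>j\<in>{Suc i, Suc i'}. of_rat (c j) * l j)"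
      using i by (intro sum.mono_neutral_right) (auto simp: c_def)
    also have "\<dots> = 0" using i by (simp add: c_def \<eta>_def)
    finally have "c (Suc i) = 0" by (rule indep) (use i in auto)
    then show False by (simp add: c_def)
  qed
  interpret M: Modules.module "\<lambda>r. (*) (real_of_int r)"
    by (simp add: Modules.module.intro distrib_left mult.commute)
  have "M.independent (\<eta> ` {..<n})"
  proof
    assume "M.dependent (\<eta> ` {..<n})"
    then obtain u where u: "\<exists>v\<in>\<eta> ` {..<n}. u v \<noteq> 0" "(\<Sum>v\<in>\<eta> ` {..<n}. real_of_int (u v) * v) = 0"
      by (auto simp: M.dependent_finite)
    have "(\<Sum>j\<in>{1..n}. of_rat (of_int (u (l j))) * l j) = (\<Sum>i<n. real_of_int (u (\<eta> i)) * \<eta> i)"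
      by (simp add: sum.atLeast1_atMost_eq \<eta>_def)
    also have "\<dots> = 0" using u(2) by (simp add: sum.reindex[OF inj])
    finally have "of_int (u (l j)) = (0 :: rat)" if "j \<in> {1..n}" for j by (rule indep) (rule that)
    then have "u (\<eta> i) = 0" if "i < n" for i using that by (simp add: \<eta>_def)
    with u(1) show False by auto
  qed
  then obtain t\<^sub>0 h\<^sub>0 where t0: "\<And>i. i < n \<Longrightarrow> \<bar>t\<^sub>0 * \<eta> i - of_int (h\<^sub>0 i) - \<theta> (Suc i) / (2 * pi)\<bar> < \<delta> / 2"
    using Kronecker_thm_1[of \<eta> n "\<delta> / 2" "\<lambda>i. \<theta> (Suc i) / (2 * pi)"] inj \<open>\<delta> > 0\<close> by auto
  define m where "m = nat \<lceil>\<bar>K\<bar> + \<bar>t\<^sub>0\<bar>\<rceil> + 1"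
  have m: "real m > \<bar>K\<bar> + \<bar>t\<^sub>0\<bar>" unfolding m_def by linarith
  obtain N :: nat where N: "N > 0" "real m / N < \<delta> / 2"
  proof -
    obtain N :: nat where N: "2 * real m / \<delta> < N" using reals_Archimedean2 by blast
    moreover have "0 \<le> 2 * real m / \<delta>" using \<open>\<delta> > 0\<close> by simp
    ultimately have "N > 0" by (metis of_nat_0_less_iff order_le_less_trans)
    with N \<open>\<delta> > 0\<close> show thesis by (intro that[of N]) (auto simp: field_simps)
  qed
  \<comment> \<open>A simultaneous almost-period, used to move the solution beyond the bound.\<close>
  obtain q p where q: "0 < q" "\<And>i. i < n \<Longrightarrow> \<bar>of_int q * \<eta> i - of_int (p i)\<bar> < 1 / N"
    using Dirichlet_approx_simult[OF N(1), of n \<eta>] by metis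
  define t where "t = t\<^sub>0 + real m * of_int q"
  define h where "h i = h\<^sub>0 i + int m * p i" for i
  have t: "\<bar>t * \<eta> i - of_int (h i) - \<theta> (Suc i) / (2 * pi)\<bar> < \<delta>" if "i < n" for i
  proof -
    have "\<bar>real m * (of_int q * \<eta> i - of_int (p i))\<bar> \<le> real m * (1 / N)"
      unfolding abs_mult using q(2)[OF that] by (intro mult_mono) auto
    then have "\<bar>real m * (of_int q * \<eta> i - of_int (p i))\<bar> < \<delta> / 2" using N(2) by (simp only: times_divide_eq_right mult_1_right)
    moreover have "t * \<eta> i - of_int (h i) - \<theta> (Suc i) / (2 * pi) =
      (t\<^sub>0 * \<eta> i - of_int (h\<^sub>0 i) - \<theta> (Suc i) / (2 * pi)) + real m * (of_int q * \<eta> i - of_int (p i))"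
      by (simp add: t_def h_def algebra_simps)
    ultimately show ?thesis using t0[OF that] by linarith
  qed
  have "real m * 1 \<le> real m * of_int q" using q(1) by (intro mult_left_mono) auto
  then have "t > 0" "t > K" using m by (auto simp: t_def)
  show ?thesis
  proof (rule that)
    have "t * 1 \<le> t * (2 * pi)" using \<open>t > 0\<close> pi_ge_two by (intro mult_left_mono) auto
    then show "2 * pi * t > K" using \<open>t > K\<close> by (simp add: mult_ac)
    fix j assume "j \<in> {1..n}"
    then obtain i where i: "j = Suc i" "i < n" by (cases j) auto
    have "2 * pi * t * l j - 2 * pi * of_int (h i) - \<theta> j = 2 * pi * (t * \<eta> i - of_int (h i) - \<theta> (Suc i) / (2 * pi))"
      by (simp add: i \<eta>_def field_simps)
    then have "\<bar>2 * pi * t * l j - 2 * pi * of_int (h i) - \<theta> j\<bar> = 2 * pi * \<bar>t * \<eta> i - of_int (h i) - \<theta> (Suc i) / (2 * pi)\<bar>"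
      by (simp add: abs_mult)
    also have "\<dots> < 2 * pi * \<delta>" using t[OF i(2)] by simp
    finally show "\<bar>2 * pi * t * l j - 2 * pi * of_int (h (j - 1)) - \<theta> j\<bar> < \<epsilon>" by (simp add: \<delta>_def i)
  qed
qed

section \<open>The secular function at high energy\<close>

lemma shoot_tendsto:
  fixes s \<phi> :: "'b::t2_space \<Rightarrow> nat \<Rightarrow> real"
  assumes "\<And>m. ((\<lambda>x. s x m) \<longlongrightarrow> s' m) F" "\<And>i. i \<in> {1..j} \<Longrightarrow> ((\<lambda>x. \<phi> x i) \<longlongrightarrow> \<phi>' i) F"
  shows "((\<lambda>x. shoot (s x) (\<phi> x) j) \<longlongrightarrow> shoot s' \<phi>' j) F"
  using assms(2)
proof (induction j)
  case (Suc j)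
  then have *: "((\<lambda>x. shoot (s x) (\<phi> x) j) \<longlongrightarrow> shoot s' \<phi>' j) F" "((\<lambda>x. \<phi> x (Suc j)) \<longlongrightarrow> \<phi>' (Suc j)) F"
    by auto
  show ?case unfolding shoot.simps Let_def by (intro tendsto_intros assms(1) *)
qed (auto intro!: tendsto_intros assms(1))

lemma secular_tendsto:
  fixes s \<phi> :: "'b::t2_space \<Rightarrow> nat \<Rightarrow> real"
  assumes "\<And>m. ((\<lambda>x. s x m) \<longlongrightarrow> s' m) F" "\<And>j. j \<in> {1..3} \<Longrightarrow> ((\<lambda>x. \<phi> x j) \<longlongrightarrow> \<phi>' j) F"
  shows "((\<lambda>x. secular (s x) (\<phi> x)) \<longlongrightarrow> secular s' \<phi>') F"
  unfolding secular_def by (rule tendsto_snd, rule shoot_tendsto) (fact assms)+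

lemma secular_periodic:
  "secular s (\<lambda>j. \<phi> j - 2 * pi * of_int (h j)) = secular s \<phi>"
proof -
  have period: "sin (x - 2 * pi * of_int n) = sin x" "cos (x - 2 * pi * of_int n) = cos x" for x :: real and n
    using sin.minus_of_int[of x n] cos.minus_of_int[of x n] by (simp_all add: mult_ac)
  have "shoot s (\<lambda>j. \<phi> j - 2 * pi * of_int (h j)) i = shoot s \<phi> i" for i
    by (induction i) (simp_all add: Let_def period)
  then show ?thesis by (simp add: secular_def)
qed

lemma secular_expand:
  "secular s \<phi> = s 4 * (cos (\<phi> 3) * fst (shoot s \<phi> 2) + sin (\<phi> 3) * snd (shoot s \<phi> 2)) -
     (sin (\<phi> 3) * fst (shoot s \<phi> 2) - cos (\<phi> 3) * snd (shoot s \<phi> 2))"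
  "fst (shoot s \<phi> 2) = cos (\<phi> 2) * fst (shoot s \<phi> 1) + sin (\<phi> 2) * snd (shoot s \<phi> 1)"
  "snd (shoot s \<phi> 2) = s 3 * fst (shoot s \<phi> 2) - (sin (\<phi> 2) * fst (shoot s \<phi> 1) - cos (\<phi> 2) * snd (shoot s \<phi> 1))"
  "fst (shoot s \<phi> 1) = cos (\<phi> 1) + sin (\<phi> 1) * s 1"
  "snd (shoot s \<phi> 1) = s 2 * fst (shoot s \<phi> 1) - (sin (\<phi> 1) - cos (\<phi> 1) * s 1)"
proof -
  have n: "Suc 0 = 1" "Suc 1 = 2" "Suc 2 = 3" "Suc 3 = 4" by simp_all
  have 1: "shoot s \<phi> 1 = (cos (\<phi> 1) + sin (\<phi> 1) * s 1,
      s 2 * (cos (\<phi> 1) + sin (\<phi> 1) * s 1) - (sin (\<phi> 1) - cos (\<phi> 1) * s 1))"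
    using shoot.simps(2)[of s \<phi> 0, unfolded n Let_def] by simp
  note 2 = shoot.simps(2)[of s \<phi> 1, unfolded n Let_def] and 3 = shoot.simps(2)[of s \<phi> 2, unfolded n Let_def]
  show "secular s \<phi> = s 4 * (cos (\<phi> 3) * fst (shoot s \<phi> 2) + sin (\<phi> 3) * snd (shoot s \<phi> 2)) -
     (sin (\<phi> 3) * fst (shoot s \<phi> 2) - cos (\<phi> 3) * snd (shoot s \<phi> 2))"
    unfolding secular_def 3 snd_conv ..
  show "fst (shoot s \<phi> 2) = cos (\<phi> 2) * fst (shoot s \<phi> 1) + sin (\<phi> 2) * snd (shoot s \<phi> 1)"
    unfolding 2 fst_conv ..
  show "snd (shoot s \<phi> 2) = s 3 * fst (shoot s \<phi> 2) -
      (sin (\<phi> 2) * fst (shoot s \<phi> 1) - cos (\<phi> 2) * snd (shoot s \<phi> 1))"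
    unfolding 2 fst_conv snd_conv ..
  show "fst (shoot s \<phi> 1) = cos (\<phi> 1) + sin (\<phi> 1) * s 1"
    unfolding 1 fst_conv ..
  show "snd (shoot s \<phi> 1) = s 2 * fst (shoot s \<phi> 1) - (sin (\<phi> 1) - cos (\<phi> 1) * s 1)"
    unfolding 1 fst_conv snd_conv ..
qed

text \<open>
  The coefficients of the expansion of the secular function in powers of \<open>x = 1 / k\<close>. Write the jump of
  the derivative at a vertex as the identity plus a nilpotent matrix times \<open>\<alpha> m * x\<close>. The coefficient
  of \<open>x ^ r\<close> then collects the choices of \<open>r\<close> vertices, and the rotations between consecutive chosen
  vertices combine into one. The orders from 3 on are gathered in \<open>secular_rest\<close>, with \<open>x ^ 3\<close> taken
  out.
\<close>

definition secular1 :: "(nat \<Rightarrow> real) \<Rightarrow> (nat \<Rightarrow> real) \<Rightarrow> real" where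
  "secular1 \<alpha> \<phi> = (\<alpha> 1 + \<alpha> 4) * cos (\<phi> 1 + \<phi> 2 + \<phi> 3) +
     \<alpha> 2 * (cos (\<phi> 1) * cos (\<phi> 2 + \<phi> 3)) + \<alpha> 3 * (cos (\<phi> 1 + \<phi> 2) * cos (\<phi> 3))"

definition secular2 :: "(nat \<Rightarrow> real) \<Rightarrow> (nat \<Rightarrow> real) \<Rightarrow> real" where
  "secular2 \<alpha> \<phi> = \<alpha> 1 * \<alpha> 4 * sin (\<phi> 1 + \<phi> 2 + \<phi> 3) +
     \<alpha> 1 * \<alpha> 2 * (sin (\<phi> 1) * cos (\<phi> 2 + \<phi> 3)) + \<alpha> 1 * \<alpha> 3 * (sin (\<phi> 1 + \<phi> 2) * cos (\<phi> 3)) +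
     \<alpha> 2 * \<alpha> 3 * (cos (\<phi> 1) * sin (\<phi> 2) * cos (\<phi> 3)) +
     \<alpha> 2 * \<alpha> 4 * (cos (\<phi> 1) * sin (\<phi> 2 + \<phi> 3)) + \<alpha> 3 * \<alpha> 4 * (cos (\<phi> 1 + \<phi> 2) * sin (\<phi> 3))"

definition secular_rest :: "(nat \<Rightarrow> real) \<Rightarrow> real \<Rightarrow> (nat \<Rightarrow> real) \<Rightarrow> real" where
  "secular_rest \<alpha> x \<phi> =
     \<alpha> 1 * \<alpha> 2 * \<alpha> 3 * (sin (\<phi> 1) * sin (\<phi> 2) * cos (\<phi> 3)) +
     \<alpha> 1 * \<alpha> 2 * \<alpha> 4 * (sin (\<phi> 1) * sin (\<phi> 2 + \<phi> 3)) +
     \<alpha> 1 * \<alpha> 3 * \<alpha> 4 * (sin (\<phi> 1 + \<phi> 2) * sin (\<phi> 3)) +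
     \<alpha> 2 * \<alpha> 3 * \<alpha> 4 * (cos (\<phi> 1) * sin (\<phi> 2) * sin (\<phi> 3)) +
     x * (\<alpha> 1 * \<alpha> 2 * \<alpha> 3 * \<alpha> 4 * (sin (\<phi> 1) * sin (\<phi> 2) * sin (\<phi> 3)))"

lemma secular_expansion:
  "secular (\<lambda>m. \<alpha> m * x) \<phi> =
     - sin (\<phi> 1 + \<phi> 2 + \<phi> 3) + x * (secular1 \<alpha> \<phi> + x * (secular2 \<alpha> \<phi> + x * secular_rest \<alpha> x \<phi>))"
  unfolding secular_expand secular1_def secular2_def secular_rest_def cos_add sin_add
  by (simp add: algebra_simps)

text \<open>
  For \<open>\<theta> 1 + \<theta> 2 + \<theta> 3 = 0\<close>, the leading term \<open>- sin (k * L)\<close> of the secular function, with \<open>L\<close> the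
  total length, vanishes where the phases \<open>k * l j\<close> equal \<open>\<theta> j\<close> modulo \<open>2 * pi\<close>. Kronecker's theorem
  gives large \<open>t\<close> at which this nearly happens. Close to such a \<open>t\<close> the secular function itself
  changes sign, because it differs from its leading term by a quantity of order \<open>1 / t\<close>.
\<close>

lemma resonance:
  fixes l \<theta> \<alpha> :: "nat \<Rightarrow> real"
  assumes indep: "rationally_independent {1..3} l" and l: "\<And>j. j \<in> {1..3} \<Longrightarrow> l j > 0"
    and \<theta>: "\<theta> 1 + \<theta> 2 + \<theta> 3 = 0" and "\<delta> > 0"
  obtains k h where "k > K" "secular (\<lambda>m. \<alpha> m / k) (\<lambda>j. k * l j) = 0"
    "\<And>j. j \<in> {1..3} \<Longrightarrow> \<bar>k * l j - 2 * pi * of_int (h j) - \<theta> j\<bar> < \<delta>"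
proof -
  define L where "L = l 1 + l 2 + l 3"
  have "L > 0" using l[of 1] l[of 2] l[of 3] by (simp add: L_def)
  have lL: "l j < L" if "j \<in> {1..3}" for j
  proof -
    have "j = 1 \<or> j = 2 \<or> j = 3" using that by auto
    then show ?thesis using l[of 1] l[of 2] l[of 3] by (auto simp: L_def)
  qed
  \<comment> \<open>Within distance \<open>\<epsilon>\<close> of \<open>t\<close>, the phases move by at most \<open>\<delta> / 2\<close>, and their sum by at most 1, which
      is less than \<open>pi\<close>, so that the sine has opposite signs at the two ends.\<close>
  define \<epsilon> where "\<epsilon> = min 1 (\<delta> / 2) / L"
  have \<epsilon>: "\<epsilon> > 0" "\<epsilon> * L \<le> 1" "\<epsilon> * L \<le> \<delta> / 2" using \<open>L > 0\<close> \<open>\<delta> > 0\<close> by (auto simp: \<epsilon>_def)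
  have "\<exists>t h. t > real n \<and> (\<forall>j\<in>{1..3}. \<bar>t * l j - 2 * pi * of_int (h j) - \<theta> j\<bar> < 1 / real (Suc n))" for n
    using Kronecker_rationally_independent[OF indep, of "1 / real (Suc n)" "real n" \<theta>] by (metis of_nat_0_less_iff zero_less_Suc zero_less_divide_1_iff)
  then obtain t h where t: "\<And>n. t n > real n"
    and h: "\<And>n j. j \<in> {1..3} \<Longrightarrow> \<bar>t n * l j - 2 * pi * of_int (h n j) - \<theta> j\<bar> < 1 / real (Suc n)"
    by metis
  have t_top: "filterlim t at_top sequentially"
    by (rule filterlim_at_top_mono[OF filterlim_real_sequentially]) (use t in \<open>auto intro!: always_eventually less_imp_le\<close>)
  define \<psi> where "\<psi> n j = t n * l j - 2 * pi * of_int (h n j)" for n j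
  have \<psi>: "(\<lambda>n. \<psi> n j) \<longlonglongrightarrow> \<theta> j" if j: "j \<in> {1..3}" for j
  proof (rule LIM_zero_cancel, rule tendsto_rabs_zero_cancel, rule tendsto_sandwich[OF _ _ tendsto_const LIMSEQ_inverse_real_of_nat])
    show "\<forall>\<^sub>F n in sequentially. \<bar>\<psi> n j - \<theta> j\<bar> \<le> inverse (real (Suc n))"
      using h[OF j] j by (auto simp: \<psi>_def inverse_eq_divide intro!: always_eventually less_imp_le)
  qed auto
  define f where "f k = secular (\<lambda>m. \<alpha> m / k) (\<lambda>j. k * l j)" for k
  have lim: "(\<lambda>n. f (t n + e)) \<longlonglongrightarrow> - sin (e * L)" for e
  proof -
    have "f (t n + e) = secular (\<lambda>m. \<alpha> m / (e + t n)) (\<lambda>j. \<psi> n j + e * l j)" for n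
      using secular_periodic[of "\<lambda>m. \<alpha> m / (e + t n)" "\<lambda>j. (t n + e) * l j" "h n"]
      by (simp add: f_def \<psi>_def algebra_simps del: times_divide_eq_right)
    moreover have "filterlim (\<lambda>n. e + t n) at_infinity sequentially"
      by (intro filterlim_at_top_imp_at_infinity filterlim_tendsto_add_at_top[OF tendsto_const] t_top)
    then have "(\<lambda>n. secular (\<lambda>m. \<alpha> m / (e + t n)) (\<lambda>j. \<psi> n j + e * l j))
        \<longlonglongrightarrow> secular (\<lambda>_. 0) (\<lambda>j. \<theta> j + e * l j)"
      by (intro secular_tendsto tendsto_intros \<psi> tendsto_divide_0[OF tendsto_const])
    moreover have "secular (\<lambda>_. 0) (\<lambda>j. \<theta> j + e * l j) = - sin (\<theta> 1 + \<theta> 2 + \<theta> 3 + e * L)"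
      using secular_expansion[of \<alpha> 0 "\<lambda>j. \<theta> j + e * l j"] by (simp add: L_def algebra_simps)
    ultimately show ?thesis using \<theta> by simp
  qed
  have s: "sin (\<epsilon> * L) > 0" using \<epsilon> \<open>L > 0\<close> pi_gt3 by (intro sin_gt_zero) auto
  have "\<forall>\<^sub>F n in sequentially. f (t n + \<epsilon>) < 0"
    using order_tendstoD(2)[OF lim[of \<epsilon>], of 0] s by simp
  moreover have "\<forall>\<^sub>F n in sequentially. f (t n + (- \<epsilon>)) > 0"
    using order_tendstoD(1)[OF lim[of "- \<epsilon>"], of 0] s by simp
  moreover have "\<forall>\<^sub>F n in sequentially. t n > max K 0 + \<epsilon>"
    using t_top by (auto simp: filterlim_at_top_dense)
  moreover have "\<forall>\<^sub>F n in sequentially. inverse (real (Suc n)) < \<delta> / 2"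
    using order_tendstoD(2)[OF LIMSEQ_inverse_real_of_nat, of "\<delta> / 2"] \<open>\<delta> > 0\<close> by simp
  ultimately have "\<forall>\<^sub>F n in sequentially. f (t n + \<epsilon>) < 0 \<and> f (t n + (- \<epsilon>)) > 0 \<and> t n > max K 0 + \<epsilon> \<and>
    inverse (real (Suc n)) < \<delta> / 2"
    by eventually_elim auto
  then obtain n where n: "f (t n + \<epsilon>) < 0" "f (t n - \<epsilon>) > 0" "t n > max K 0 + \<epsilon>" "inverse (real (Suc n)) < \<delta> / 2"
    using eventually_happens'[OF sequentially_bot] by fastforce
  have "continuous_on {t n - \<epsilon>..t n + \<epsilon>} f"
    unfolding f_def continuous_on_def
    by (intro ballI secular_tendsto tendsto_intros) (use n(3) in auto)
  then obtain k where k: "t n - \<epsilon> \<le> k" "k \<le> t n + \<epsilon>" "f k = 0"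
    using IVT2'[of f "t n + \<epsilon>" 0 "t n - \<epsilon>"] n \<epsilon>(1) by auto
  show ?thesis
  proof (rule that)
    show "k > K" using k n(3) by auto
    show "secular (\<lambda>m. \<alpha> m / k) (\<lambda>j. k * l j) = 0" using k(3) by (simp add: f_def)
    fix j :: nat assume j: "j \<in> {1..3}"
    have "\<bar>(k - t n) * l j\<bar> \<le> \<epsilon> * L"
      unfolding abs_mult using k lL[OF j] l[OF j] \<epsilon>(1) by (intro mult_mono) auto
    then have "\<bar>k * l j - t n * l j\<bar> \<le> \<delta> / 2" using \<epsilon>(3) by (simp add: left_diff_distrib)
    then show "\<bar>k * l j - 2 * pi * of_int (h n j) - \<theta> j\<bar> < \<delta>"
      using h[OF j, of n] n(4) unfolding inverse_eq_divide by linarith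
  qed
qed

lemma resonant_sequence:
  fixes l \<theta> \<alpha> :: "nat \<Rightarrow> real"
  assumes indep: "rationally_independent {1..3} l" and l: "\<And>j. j \<in> {1..3} \<Longrightarrow> l j > 0"
    and \<theta>: "\<theta> 1 + \<theta> 2 + \<theta> 3 = 0"
  obtains k h where "\<forall>n. k n > 0" "(\<lambda>n. 1 / k n) \<longlonglongrightarrow> 0"
    "\<forall>n. secular (\<lambda>m. \<alpha> m / k n) (\<lambda>j. k n * l j) = 0"
    "\<forall>j\<in>{1..3}. (\<lambda>n. k n * l j - 2 * pi * of_int (h n j)) \<longlonglongrightarrow> \<theta> j"
proof -
  have "\<exists>k h. k > real n \<and> secular (\<lambda>m. \<alpha> m / k) (\<lambda>j. k * l j) = 0 \<and>
    (\<forall>j\<in>{1..3}. \<bar>k * l j - 2 * pi * of_int (h j) - \<theta> j\<bar> < inverse (real (Suc n)))" for n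
    using resonance[OF indep l \<theta>, of "inverse (real (Suc n))" "real n" \<alpha>]
    by (metis inverse_positive_iff_positive of_nat_0_less_iff zero_less_Suc)
  then obtain k h where k: "\<And>n. k n > real n" and 0: "\<And>n. secular (\<lambda>m. \<alpha> m / k n) (\<lambda>j. k n * l j) = 0"
    and h: "\<And>n j. j \<in> {1..3} \<Longrightarrow> \<bar>k n * l j - 2 * pi * of_int (h n j) - \<theta> j\<bar> < inverse (real (Suc n))"
    by metis
  show ?thesis
  proof (rule that[of k h])
    show "\<forall>n. k n > 0" using k by (meson of_nat_0_le_iff order_le_less_trans)
    have "filterlim k at_top sequentially"
      by (rule filterlim_at_top_mono[OF filterlim_real_sequentially]) (use k in \<open>auto intro!: always_eventually less_imp_le\<close>)
    then show "(\<lambda>n. 1 / k n) \<longlonglongrightarrow> 0"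
      by (intro tendsto_divide_0[OF tendsto_const] filterlim_at_top_imp_at_infinity)
    have "(\<lambda>n. k n * l j - 2 * pi * of_int (h n j)) \<longlonglongrightarrow> \<theta> j" if j: "j \<in> {1..3}" for j
      by (rule LIM_zero_cancel, rule tendsto_rabs_zero_cancel,
          rule tendsto_sandwich[OF _ _ tendsto_const LIMSEQ_inverse_real_of_nat])
        (use h[OF j] in \<open>auto intro!: always_eventually less_imp_le\<close>)
    then show "\<forall>j\<in>{1..3}. (\<lambda>n. k n * l j - 2 * pi * of_int (h n j)) \<longlonglongrightarrow> \<theta> j" by blast
  qed (use 0 in blast)
qed

text \<open>
  Along a resonant sequence both secular functions vanish. Their leading terms \<open>- sin (k * L)\<close> agree
  and cancel exactly, so that the first order terms must agree in the limit, and where these agree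
  identically, the second order terms.
\<close>

lemma secular_coefficients_eq:
  fixes l \<alpha> \<alpha>' :: "nat \<Rightarrow> real"
  assumes indep: "rationally_independent {1..3} l" and l: "\<And>j. j \<in> {1..3} \<Longrightarrow> l j > 0"
    and zeros: "\<And>k. k > 0 \<Longrightarrow> secular (\<lambda>m. \<alpha> m / k) (\<lambda>j. k * l j) = 0 \<Longrightarrow>
      secular (\<lambda>m. \<alpha>' m / k) (\<lambda>j. k * l j) = 0"
    and \<theta>: "\<theta> 1 + \<theta> 2 + \<theta> 3 = 0"
  shows "secular1 \<alpha> \<theta> = secular1 \<alpha>' \<theta>"
    and "(\<And>\<phi>. secular1 \<alpha> \<phi> = secular1 \<alpha>' \<phi>) \<Longrightarrow> secular2 \<alpha> \<theta> = secular2 \<alpha>' \<theta>"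
proof -
  obtain k h where k: "\<forall>n. k n > 0" "(\<lambda>n. 1 / k n) \<longlonglongrightarrow> 0"
    and zero: "\<forall>n. secular (\<lambda>m. \<alpha> m / k n) (\<lambda>j. k n * l j) = 0"
    and lim: "\<forall>j\<in>{1..3}. (\<lambda>n. k n * l j - 2 * pi * of_int (h n j)) \<longlonglongrightarrow> \<theta> j"
    by (rule resonant_sequence[OF indep l \<theta>, of \<alpha>])
  define x where "x n = 1 / k n" for n
  define \<psi> where "\<psi> n j = k n * l j - 2 * pi * of_int (h n j)" for n j
  have x: "x n \<noteq> 0" "x \<longlonglongrightarrow> 0" for n using k(1)[rule_format, of n] k(2) by (simp_all add: x_def[abs_def])
  have \<psi>: "(\<lambda>n. \<psi> n 1) \<longlonglongrightarrow> \<theta> 1" "(\<lambda>n. \<psi> n 2) \<longlonglongrightarrow> \<theta> 2" "(\<lambda>n. \<psi> n 3) \<longlonglongrightarrow> \<theta> 3"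
    using lim by (simp_all add: \<psi>_def)
  have "secular (\<lambda>m. \<beta> m * x n) (\<psi> n) = secular (\<lambda>m. \<beta> m / k n) (\<lambda>j. k n * l j)" for \<beta> n
    unfolding \<psi>_def x_def using secular_periodic[of "\<lambda>m. \<beta> m / k n" "\<lambda>j. k n * l j" "h n"] by simp
  then have same: "secular (\<lambda>m. \<alpha> m * x n) (\<psi> n) = secular (\<lambda>m. \<alpha>' m * x n) (\<psi> n)" for n
    using zero[rule_format, of n] zeros[OF k(1)[rule_format] zero[rule_format], of n] by simp
  have eq: "secular1 \<alpha> (\<psi> n) + x n * (secular2 \<alpha> (\<psi> n) + x n * secular_rest \<alpha> (x n) (\<psi> n)) =
      secular1 \<alpha>' (\<psi> n) + x n * (secular2 \<alpha>' (\<psi> n) + x n * secular_rest \<alpha>' (x n) (\<psi> n))" for n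
    using same[of n] x(1)[of n] unfolding secular_expansion by simp
  have lim1: "(\<lambda>n. secular1 \<beta> (\<psi> n)) \<longlonglongrightarrow> secular1 \<beta> \<theta>" for \<beta>
    unfolding secular1_def by (intro tendsto_intros \<psi>)
  have lim2: "(\<lambda>n. secular2 \<beta> (\<psi> n)) \<longlonglongrightarrow> secular2 \<beta> \<theta>" for \<beta>
    unfolding secular2_def by (intro tendsto_intros \<psi>)
  have limr: "(\<lambda>n. secular_rest \<beta> (x n) (\<psi> n)) \<longlonglongrightarrow> secular_rest \<beta> 0 \<theta>" for \<beta>
    unfolding secular_rest_def by (intro tendsto_intros \<psi> x(2))
  have "(\<lambda>n. secular1 \<beta> (\<psi> n) + x n * (secular2 \<beta> (\<psi> n) + x n * secular_rest \<beta> (x n) (\<psi> n)))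
      \<longlonglongrightarrow> secular1 \<beta> \<theta> + 0 * (secular2 \<beta> \<theta> + 0 * secular_rest \<beta> 0 \<theta>)" for \<beta>
    by (intro tendsto_intros lim1 lim2 limr x(2))
  from this[of \<alpha>] this[of \<alpha>'] show "secular1 \<alpha> \<theta> = secular1 \<alpha>' \<theta>"
    unfolding eq by (simp add: LIMSEQ_unique)
  assume "\<And>\<phi>. secular1 \<alpha> \<phi> = secular1 \<alpha>' \<phi>"
  then have eq2: "secular2 \<alpha> (\<psi> n) + x n * secular_rest \<alpha> (x n) (\<psi> n) =
      secular2 \<alpha>' (\<psi> n) + x n * secular_rest \<alpha>' (x n) (\<psi> n)" for n
    using eq[of n] x(1)[of n] by simp
  have "(\<lambda>n. secular2 \<beta> (\<psi> n) + x n * secular_rest \<beta> (x n) (\<psi> n))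
      \<longlonglongrightarrow> secular2 \<beta> \<theta> + 0 * secular_rest \<beta> 0 \<theta>" for \<beta>
    by (intro tendsto_intros lim2 limr x(2))
  from this[of \<alpha>] this[of \<alpha>'] show "secular2 \<alpha> \<theta> = secular2 \<alpha>' \<theta>"
    unfolding eq2 by (simp add: LIMSEQ_unique)
qed

section \<open>Uniqueness of the coupling constants\<close>

theorem proposition5p1:
  fixes \<Gamma> :: metric_graph and \<alpha> \<alpha>' :: "nat \<Rightarrow> real"
  assumes "chain_A4 \<Gamma>"
    and "rationally_independent {1, 2, 3} (edge_length \<Gamma>)"
    and "\<alpha> 2 \<noteq> 0" and "\<alpha> 3 \<noteq> 0" and "\<alpha>' 2 \<noteq> 0" and "\<alpha>' 3 \<noteq> 0"
    and "isospectral \<Gamma> (laplacian \<Gamma> \<alpha>) (laplacian \<Gamma> \<alpha>')"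
  shows "\<forall>k\<in>{1, 2, 3, 4}. \<alpha> k = \<alpha>' k"
proof -
  have "{1..3} = {1, 2, 3 :: nat}" by auto
  then have indep: "rationally_independent {1..3} (edge_length \<Gamma>)" using assms(2) by simp
  have pos: "edge_length \<Gamma> j > 0" if "j \<in> {1..3}" for j
    using assms(1) that by (auto simp: chain_A4_def wf_graph_def edge_length_def)
  have zeros: "secular (\<lambda>m. \<alpha>' m / k) (\<lambda>j. k * edge_length \<Gamma> j) = 0"
    if "k > 0" "secular (\<lambda>m. \<alpha> m / k) (\<lambda>j. k * edge_length \<Gamma> j) = 0" for k
    using isospectral_imp_secular_eq_0[OF assms(1,7) that] .
  \<comment> \<open>A two-parameter family that exhausts the phases with sum 0.\<close>
  define \<theta> :: "real \<Rightarrow> real \<Rightarrow> nat \<Rightarrow> real" where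
    "\<theta> y z j = (if j = 1 then y else if j = 2 then - y - z else z)" for y z j
  have \<theta>: "\<theta> y z 1 = y" "\<theta> y z 2 = - y - z" "\<theta> y z 3 = z" for y z
    by (simp_all add: \<theta>_def)
  have sum0: "\<theta> y z 1 + \<theta> y z 2 + \<theta> y z 3 = 0" for y z
    by (simp add: \<theta>_def)
  have first: "\<alpha> 1 + \<alpha> 4 + \<alpha> 2 * (cos y)\<^sup>2 + \<alpha> 3 * (cos z)\<^sup>2 =
      \<alpha>' 1 + \<alpha>' 4 + \<alpha>' 2 * (cos y)\<^sup>2 + \<alpha>' 3 * (cos z)\<^sup>2" for y z
  proof -
    have "secular1 \<alpha> (\<theta> y z) = secular1 \<alpha>' (\<theta> y z)"
      by (rule secular_coefficients_eq(1)[OF indep pos zeros sum0])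
    then show ?thesis unfolding secular1_def sum0 unfolding \<theta> by (simp add: power2_eq_square)
  qed
  have ends: "\<alpha> 1 + \<alpha> 4 = \<alpha>' 1 + \<alpha>' 4" and 2: "\<alpha> 2 = \<alpha>' 2" and 3: "\<alpha> 3 = \<alpha>' 3"
    using first[of "pi / 2" "pi / 2"] first[of 0 "pi / 2"] first[of "pi / 2" 0] by simp_all
  have lin: "secular1 \<alpha> \<phi> = secular1 \<alpha>' \<phi>" for \<phi>
    unfolding secular1_def ends 2 3 ..
  \<comment> \<open>On phases \<open>(y, - y - z, z)\<close> the unknown part of the second order term is
      \<open>(\<alpha> 1 - \<alpha> 4) * (\<alpha> 2 * sin y * cos y - \<alpha> 3 * sin z * cos z)\<close>. The choice \<open>z = 0\<close> isolates
      \<open>\<alpha> 2\<close>.\<close>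
  have "secular2 \<alpha> (\<theta> (pi / 4) 0) = secular2 \<alpha>' (\<theta> (pi / 4) 0)"
    by (rule secular_coefficients_eq(2)[OF indep pos zeros sum0 lin])
  then have "\<alpha>' 2 * \<alpha> 1 - \<alpha>' 2 * \<alpha> 4 = \<alpha>' 2 * \<alpha>' 1 - \<alpha>' 2 * \<alpha>' 4"
    unfolding secular2_def sum0 unfolding \<theta> 2 3 by (simp add: cos_45 sin_45 algebra_simps)
  then have "\<alpha> 1 - \<alpha> 4 = \<alpha>' 1 - \<alpha>' 4"
    using assms(5) by (simp flip: right_diff_distrib)
  with ends 2 3 show ?thesis by auto
qed

end
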